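(* Each consistent Horn-$\mathcal{ALCHIQ}$ knowledge base $(\mathcal{T},\mathcal{A})$ has a unique (up to isomorphism) universal core model, namely the austere canonical model $\mathit{can}(\mathcal{T},\mathcal{A})$.
   Context: A universal model of $(\mathcal{T},\mathcal{A})$ is a model admitting a homomorphism (identity on individuals, preserving concept and role atoms) into every model; a core is an interpretation all of whose endomorphisms are strong injective homomorphisms. $\mathcal{T}$ is a normalised Horn-$\mathcal{ALCHIQ}$ TBox (concept inclusions $A_0\sqcap\dots\sqcap A_n\sqsubseteq B$, $A\sqsubseteq{\leq_1}r.B$, $A\sqsubseteq\forall r.B$, $A\sqsubseteq\exists r.B$, role inclusions $r\sqsubseteq r'$). For finite sets $M$ of concept names, $\sqcap M$ is the conjunction of its elements; $\exists(\sqcap R).(\sqcap N)$ holds at $e$ iff some $e'$ is an $r$-successor of $e$ for every $r\in R$ and belongs to every $A\in N$. 2-types are triples in $\mathcal{P}(N_C)\times\mathcal{P}(\text{roles})\times\mathcal{P}(N_C)$, 1½-types pairs in $\mathcal{P}(\text{roles})\times\mathcal{P}(N_C)$; $\pi_i$ is the $i$-th projection; $\mathit{inv}(t)=(\pi_3(t),\{r^-\mid r\in\pi_2(t)\},\pi_1(t))$. The good successor configuration $\mathrm{succ}_{\mathcal{T}}(F)$ of a set $F$ of 2-types with equal first components is the unique set of 1½-types such that (R1) whenever $M\subseteq\pi_1(t)$ for some $t\in F$, $\mathcal{T}\models\sqcap M\sqsubseteq\exists(\sqcap R).(\sqcap N)$ and no $t\in F$ has $R\subseteq\pi_2(t)$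 and $N\subseteq\pi_3(t)$, some member $u$ has $R\subseteq\pi_1(u)$, $N\subseteq\pi_2(u)$; (R2) every member $u$ satisfies $\mathcal{T}\models\sqcap M\sqsubseteq\exists(\sqcap\pi_1(u)).(\sqcap\pi_2(u))$ for some $M\subseteq\pi_1(t)$, $t\in F$; (R3) no two distinct members $u,u'$ have $\pi_1(u)\subseteq\pi_1(u')$, $\pi_2(u)\subseteq\pi_2(u')$; (R4) no member $u$ and $t\in F$ have $\pi_1(u)\subseteq\pi_2(t)$ and $\pi_2(u)\subseteq\pi_3(t)$. $t'$ is a child of $t$ iff $\pi_1(t')=\pi_3(t)$ and $(\pi_2(t'),\pi_3(t'))\in\mathrm{succ}_{\mathcal{T}}(\mathit{inv}(t))$. $\mathcal{A}_{\mathcal{T}}$ is the closure of $\mathcal{A}$ on its individuals under the non-existential consequences of $\mathcal{T}$ (entailed conjunctive concept inclusions, $\forall$-axioms, entailed role inclusions incl. inverses, and the ${\leq_1}$-merging rule). $\mathit{can}(\mathcal{T},\mathcal{A})$ has domain the individuals of $\mathcal{A}$ plus words $ak_1\dots k_n$ with $\pi_1(k_1)$ the concepts of $a$ in $\mathcal{A}_{\mathcal{T}}$, $(\pi_2(k_1),\pi_3(k_1))\in\mathrm{succ}_{\mathcal{T}}(T_a)$ ($T_a$ consisting of $(\text{concepts of }a,\emptyset,\emptyset)$ and, for each $\mathcal{A}_{\mathcal{T}}$-neighbour $b$, the triple of concepts of $a$, roles from $a$ to $b$, concepts of $b$), and $k_{i+1}$ a child of $k_i$; individuals carry their $\mathcal{A}_{\mathcal{T}}$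 facts, word $w$ has the concepts in $\pi_3$ of its last 2-type, $(w,wk)\in r$ iff $r\in\pi_2(k)$, $(wk,w)\in r$ iff $r^-\in\pi_2(k)$.
   Formalization: Role sets R in entailed ∃(⊓R).(⊓N) (R1, R2, merging rule) are required nonempty: for T=∅, A={A(a)}, R=∅ would add a disconnected copy of a, so can would not be a core. The ABox is required nonempty, as otherwise can has empty domain. *)

theory Defs
  imports Main "HOL-Library.Countable_Set"
begin

section \<open>Syntax\<close>

datatype 'r role = Role 'r | Inv 'r

fun rinv :: "'r role \<Rightarrow> 'r role" where
  "rinv (Role r) = Inv r"
| "rinv (Inv r) = Role r"

datatype 'c basic = Top | Bot | Name 'c

datatype ('c, 'r) tbox_axiom =
    ConjSub "'c basic list" "'c basic"
  | AtMostOne "'c basic" "'r role" "'c basic"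
  | ForallSub "'c basic" "'r role" "'c basic"
  | ExistsSub "'c basic" "'r role" "'c basic"
  | RoleSub "'r role" "'r role"

datatype ('i, 'c, 'r) assertion = CA 'c 'i | RA 'r 'i 'i

fun role_assertion :: "'r role \<Rightarrow> 'i \<Rightarrow> 'i \<Rightarrow> ('i, 'c, 'r) assertion" where
  "role_assertion (Role r) a b = RA r a b"
| "role_assertion (Inv r) a b = RA r b a"

fun assertion_inds :: "('i, 'c, 'r) assertion \<Rightarrow> 'i set" where
  "assertion_inds (CA A a) = {a}"
| "assertion_inds (RA r a b) = {a, b}"

definition inds :: "('i, 'c, 'r) assertion set \<Rightarrow> 'i set" where
  "inds \<A> = (\<Union>\<alpha>\<in>\<A>. assertion_inds \<alpha>)"


section \<open>Semantics\<close>

record ('d, 'c, 'r) interp =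
  universe :: "'d set"
  cext :: "'c \<Rightarrow> 'd set"
  rext :: "'r \<Rightarrow> ('d \<times> 'd) set"

record ('d, 'c, 'r, 'i) ind_interp = "('d, 'c, 'r) interp" +
  den :: "'i \<Rightarrow> 'd"

definition is_interp :: "('d, 'c, 'r, 'z) interp_scheme \<Rightarrow> bool" where
  "is_interp I \<longleftrightarrow> universe I \<noteq> {} \<and> (\<forall>A. cext I A \<subseteq> universe I) \<and>
     (\<forall>r. rext I r \<subseteq> universe I \<times> universe I)"

fun basic_ext :: "('d, 'c, 'r, 'z) interp_scheme \<Rightarrow> 'c basic \<Rightarrow> 'd set" where
  "basic_ext I Top = universe I"
| "basic_ext I Bot = {}"
| "basic_ext I (Name A) = cext I A"

fun role_ext :: "('d, 'c, 'r, 'z) interp_scheme \<Rightarrow> 'r role \<Rightarrow> ('d \<times> 'd) set" where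
  "role_ext I (Role r) = rext I r"
| "role_ext I (Inv r) = (rext I r)\<inverse>"

fun sat_axiom :: "('d, 'c, 'r, 'z) interp_scheme \<Rightarrow> ('c, 'r) tbox_axiom \<Rightarrow> bool" where
  "sat_axiom I (ConjSub As B) \<longleftrightarrow>
     {e \<in> universe I. \<forall>A\<in>set As. e \<in> basic_ext I A} \<subseteq> basic_ext I B"
| "sat_axiom I (AtMostOne A r B) \<longleftrightarrow>
     (\<forall>e\<in>basic_ext I A. \<forall>f\<in>basic_ext I B. \<forall>g\<in>basic_ext I B.
        (e, f) \<in> role_ext I r \<longrightarrow> (e, g) \<in> role_ext I r \<longrightarrow> f = g)"
| "sat_axiom I (ForallSub A r B) \<longleftrightarrow>
     (\<forall>e\<in>basic_ext I A. \<forall>f. (e, f) \<in> role_ext I r \<longrightarrow> f \<in> basic_ext I B)"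
| "sat_axiom I (ExistsSub A r B) \<longleftrightarrow>
     (\<forall>e\<in>basic_ext I A. \<exists>f\<in>basic_ext I B. (e, f) \<in> role_ext I r)"
| "sat_axiom I (RoleSub r s) \<longleftrightarrow> role_ext I r \<subseteq> role_ext I s"

definition sat_tbox :: "('d, 'c, 'r, 'z) interp_scheme \<Rightarrow> ('c, 'r) tbox_axiom set \<Rightarrow> bool" where
  "sat_tbox I \<T> \<longleftrightarrow> is_interp I \<and> (\<forall>\<tau>\<in>\<T>. sat_axiom I \<tau>)"

fun sat_assertion :: "('d, 'c, 'r, 'i) ind_interp \<Rightarrow> ('i, 'c, 'r) assertion \<Rightarrow> bool" where
  "sat_assertion I (CA A a) \<longleftrightarrow> den I a \<in> cext I A"
| "sat_assertion I (RA r a b) \<longleftrightarrow> (den I a, den I b) \<in> rext I r"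

text \<open>Individuals are standard names: up to renaming of domain elements this says that distinct
  individuals of the ABox denote distinct elements.  The denotation of individuals that do not
  occur in the ABox is irrelevant.\<close>

definition is_model :: "('d, 'c, 'r, 'i) ind_interp \<Rightarrow> ('c, 'r) tbox_axiom set \<Rightarrow>
    ('i, 'c, 'r) assertion set \<Rightarrow> bool" where
  "is_model I \<T> \<A> \<longleftrightarrow> sat_tbox I \<T> \<and> den I ` inds \<A> \<subseteq> universe I \<and> inj_on (den I) (inds \<A>) \<and>
     (\<forall>\<alpha>\<in>\<A>. sat_assertion I \<alpha>)"

text \<open>A definition cannot quantify over all types; notions that refer to all models take the type
  of the domain elements as a parameter.  As a conclusion, such a notion is meant with a type variable
  for the parameter; as a hypothesis on a given interpretation, universality with respect to models
  over one particular type is weaker than, hence covers, universality with respect to all models.\<close>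

definition consistent :: "'d itself \<Rightarrow> ('c, 'r) tbox_axiom set \<Rightarrow> ('i, 'c, 'r) assertion set \<Rightarrow> bool"
  where "consistent _ \<T> \<A> \<longleftrightarrow> (\<exists>I :: ('d, 'c, 'r, 'i) ind_interp. is_model I \<T> \<A>)"


section \<open>Homomorphisms, universal models and cores\<close>

definition homomorphism :: "'i set \<Rightarrow> ('d \<Rightarrow> 'e) \<Rightarrow> ('d, 'c, 'r, 'i) ind_interp \<Rightarrow>
    ('e, 'c, 'r, 'i) ind_interp \<Rightarrow> bool" where
  "homomorphism X h I J \<longleftrightarrow> h ` universe I \<subseteq> universe J \<and>
     (\<forall>a\<in>X. h (den I a) = den J a) \<and>
     (\<forall>A. \<forall>e\<in>universe I. e \<in> cext I A \<longrightarrow> h e \<in> cext J A) \<and>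
     (\<forall>r. \<forall>e\<in>universe I. \<forall>f\<in>universe I. (e, f) \<in> rext I r \<longrightarrow> (h e, h f) \<in> rext J r)"

definition strong_homomorphism :: "'i set \<Rightarrow> ('d \<Rightarrow> 'e) \<Rightarrow> ('d, 'c, 'r, 'i) ind_interp \<Rightarrow>
    ('e, 'c, 'r, 'i) ind_interp \<Rightarrow> bool" where
  "strong_homomorphism X h I J \<longleftrightarrow> homomorphism X h I J \<and>
     (\<forall>A. \<forall>e\<in>universe I. h e \<in> cext J A \<longrightarrow> e \<in> cext I A) \<and>
     (\<forall>r. \<forall>e\<in>universe I. \<forall>f\<in>universe I. (h e, h f) \<in> rext J r \<longrightarrow> (e, f) \<in> rext I r)"

definition isomorphic :: "'i set \<Rightarrow> ('d, 'c, 'r, 'i) ind_interp \<Rightarrow>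
    ('e, 'c, 'r, 'i) ind_interp \<Rightarrow> bool" where
  "isomorphic X I J \<longleftrightarrow>
     (\<exists>h. bij_betw h (universe I) (universe J) \<and> strong_homomorphism X h I J)"

definition core :: "'i set \<Rightarrow> ('d, 'c, 'r, 'i) ind_interp \<Rightarrow> bool" where
  "core X I \<longleftrightarrow>
     (\<forall>h. homomorphism X h I I \<longrightarrow> strong_homomorphism X h I I \<and> inj_on h (universe I))"

definition universal_model :: "'e itself \<Rightarrow> ('c, 'r) tbox_axiom set \<Rightarrow>
    ('i, 'c, 'r) assertion set \<Rightarrow> ('d, 'c, 'r, 'i) ind_interp \<Rightarrow> bool" where
  "universal_model _ \<T> \<A> I \<longleftrightarrow> is_model I \<T> \<A> \<and>
     (\<forall>J :: ('e, 'c, 'r, 'i) ind_interp. is_model J \<T> \<A> \<longrightarrow> (\<exists>h. homomorphism (inds \<A>) h I J))"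

definition universal_core_model :: "'e itself \<Rightarrow> ('c, 'r) tbox_axiom set \<Rightarrow>
    ('i, 'c, 'r) assertion set \<Rightarrow> ('d, 'c, 'r, 'i) ind_interp \<Rightarrow> bool" where
  "universal_core_model ty \<T> \<A> I \<longleftrightarrow> universal_model ty \<T> \<A> I \<and> core (inds \<A>) I"


section \<open>Entailment of inclusions from the TBox\<close>

definition conj_ext :: "('d, 'c, 'r, 'z) interp_scheme \<Rightarrow> 'c set \<Rightarrow> 'd set" where
  "conj_ext I M = {e \<in> universe I. \<forall>A\<in>M. e \<in> cext I A}"

definition ex_ext :: "('d, 'c, 'r, 'z) interp_scheme \<Rightarrow> 'r role set \<Rightarrow> 'c set \<Rightarrow> 'd set" where
  "ex_ext I R N = {e \<in> universe I. \<exists>f\<in>conj_ext I N. \<forall>r\<in>R. (e, f) \<in> role_ext I r}"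

text \<open>Entailment is defined with models whose domain consists of natural numbers; the lemmas
  \<open>entails_concept_any_type\<close>, \<open>entails_role_any_type\<close> and \<open>entails_ex_any_type\<close> below
  show that for finite TBoxes (more generally, countable ones) this is entailment with respect to
  all models whatsoever.\<close>

definition entails_concept :: "('c, 'r) tbox_axiom set \<Rightarrow> 'c set \<Rightarrow> 'c \<Rightarrow> bool" where
  "entails_concept \<T> M B \<longleftrightarrow>
     (\<forall>I :: (nat, 'c, 'r) interp. sat_tbox I \<T> \<longrightarrow> conj_ext I M \<subseteq> cext I B)"

definition entails_role :: "('c, 'r) tbox_axiom set \<Rightarrow> 'r role \<Rightarrow> 'r role \<Rightarrow> bool" where
  "entails_role \<T> r s \<longleftrightarrow>
     (\<forall>I :: (nat, 'c, 'r) interp. sat_tbox I \<T> \<longrightarrow> role_ext I r \<subseteq> role_ext I s)"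

text \<open>Role conjunctions in existential restrictions are nonempty.  With an empty conjunction,
  which every pair of elements satisfies, each \<open>M\<close> would entail an
  \<open>M\<close>-element attached by no role, and canonical models would contain superfluous
  disconnected copies of their elements.\<close>

definition entails_ex :: "('c, 'r) tbox_axiom set \<Rightarrow> 'c set \<Rightarrow> 'r role set \<Rightarrow> 'c set \<Rightarrow> bool" where
  "entails_ex \<T> M R N \<longleftrightarrow> R \<noteq> {} \<and>
     (\<forall>I :: (nat, 'c, 'r) interp. sat_tbox I \<T> \<longrightarrow> conj_ext I M \<subseteq> ex_ext I R N)"


section \<open>Good successor configurations\<close>

type_synonym ('c, 'r) type2 = "'c set \<times> 'r role set \<times> 'c set"
type_synonym ('c, 'r) type1h = "'r role set \<times> 'c set"

abbreviation pi1 :: "('c, 'r) type2 \<Rightarrow> 'c set" where "pi1 t \<equiv> fst t"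
abbreviation pi2 :: "('c, 'r) type2 \<Rightarrow> 'r role set" where "pi2 t \<equiv> fst (snd t)"
abbreviation pi3 :: "('c, 'r) type2 \<Rightarrow> 'c set" where "pi3 t \<equiv> snd (snd t)"

definition type_inv :: "('c, 'r) type2 \<Rightarrow> ('c, 'r) type2" where
  "type_inv t = (pi3 t, rinv ` pi2 t, pi1 t)"

definition good_succ_config :: "('c, 'r) tbox_axiom set \<Rightarrow> ('c, 'r) type2 set \<Rightarrow>
    ('c, 'r) type1h set \<Rightarrow> bool" where
  "good_succ_config \<T> F S \<longleftrightarrow>
     (\<forall>M R N. (\<exists>t\<in>F. M \<subseteq> pi1 t) \<longrightarrow> entails_ex \<T> M R N \<longrightarrow>
        \<not> (\<exists>t\<in>F. R \<subseteq> pi2 t \<and> N \<subseteq> pi3 t) \<longrightarrow> (\<exists>u\<in>S. R \<subseteq> fst u \<and> N \<subseteq> snd u)) \<and>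
     (\<forall>u\<in>S. \<exists>M. (\<exists>t\<in>F. M \<subseteq> pi1 t) \<and> entails_ex \<T> M (fst u) (snd u)) \<and>
     \<not> (\<exists>u\<in>S. \<exists>u'\<in>S. u \<noteq> u' \<and> fst u \<subseteq> fst u' \<and> snd u \<subseteq> snd u') \<and>
     \<not> (\<exists>u\<in>S. \<exists>t\<in>F. fst u \<subseteq> pi2 t \<and> snd u \<subseteq> pi3 t)"

definition succ_config :: "('c, 'r) tbox_axiom set \<Rightarrow> ('c, 'r) type2 set \<Rightarrow> ('c, 'r) type1h set"
  where "succ_config \<T> F = (THE S. good_succ_config \<T> F S)"

lemma good_succ_config_subset:
  assumes S: "good_succ_config \<T> F S" and S': "good_succ_config \<T> F S'"
  shows "S \<subseteq> S'"
proof
  fix u assume u: "u \<in> S"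
  have r1: "\<exists>v\<in>X. R \<subseteq> fst v \<and> N \<subseteq> snd v"
    if "good_succ_config \<T> F X" "\<exists>t\<in>F. M \<subseteq> pi1 t" "entails_ex \<T> M R N"
       "\<not> (\<exists>t\<in>F. R \<subseteq> pi2 t \<and> N \<subseteq> pi3 t)" for X M R N
    using that unfolding good_succ_config_def by meson
  have r2: "\<exists>M. (\<exists>t\<in>F. M \<subseteq> pi1 t) \<and> entails_ex \<T> M (fst v) (snd v)"
    if "good_succ_config \<T> F X" "v \<in> X" for X v
    using that unfolding good_succ_config_def by meson
  have r3: "v = v'"
    if "good_succ_config \<T> F X" "v \<in> X" "v' \<in> X" "fst v \<subseteq> fst v'" "snd v \<subseteq> snd v'" for X v v'
    using that unfolding good_succ_config_def by meson
  have r4: "\<not> (\<exists>t\<in>F. fst v \<subseteq> pi2 t \<and> snd v \<subseteq> pi3 t)"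
    if "good_succ_config \<T> F X" "v \<in> X" for X v
    using that unfolding good_succ_config_def by meson
  obtain v where v: "v \<in> S'" "fst u \<subseteq> fst v" "snd u \<subseteq> snd v"
    using r2[OF S u] r4[OF S u] r1[OF S'] by metis
  obtain w where w: "w \<in> S" "fst v \<subseteq> fst w" "snd v \<subseteq> snd w"
    using r2[OF S' v(1)] r4[OF S' v(1)] r1[OF S] by metis
  have "u = w" using r3[OF S u w(1)] v w by blast
  then have "u = v" using v w by (auto simp: prod_eq_iff)
  then show "u \<in> S'" using v by simp
qed

lemma good_succ_config_unique:
  "good_succ_config \<T> F S \<Longrightarrow> good_succ_config \<T> F S' \<Longrightarrow> S = S'"
  by (simp add: good_succ_config_subset subset_antisym)

definition child :: "('c, 'r) tbox_axiom set \<Rightarrow> ('c, 'r) type2 \<Rightarrow> ('c, 'r) type2 \<Rightarrow> bool" where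
  "child \<T> t t' \<longleftrightarrow> pi1 t' = pi3 t \<and> (pi2 t', pi3 t') \<in> succ_config \<T> {type_inv t}"


section \<open>The completed ABox\<close>

definition has :: "('i, 'c, 'r) assertion set \<Rightarrow> 'c basic \<Rightarrow> 'i \<Rightarrow> bool" where
  "has \<A> X a \<longleftrightarrow> X = Top \<or> (\<exists>A. X = Name A \<and> CA A a \<in> \<A>)"

lemma has_mono: "(\<And>\<alpha>. p \<alpha> \<longrightarrow> q \<alpha>) \<Longrightarrow> has {\<alpha>. p \<alpha>} X a \<longrightarrow> has {\<alpha>. q \<alpha>} X a"
  unfolding has_def by auto

inductive_set closure_abox :: "('c, 'r) tbox_axiom set \<Rightarrow> ('i, 'c, 'r) assertion set \<Rightarrow>
    ('i, 'c, 'r) assertion set"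
  for \<T> :: "('c, 'r) tbox_axiom set" and \<A> :: "('i, 'c, 'r) assertion set" where
  assertion: "\<alpha> \<in> \<A> \<Longrightarrow> \<alpha> \<in> closure_abox \<T> \<A>"
| conj_incl: "a \<in> inds \<A> \<Longrightarrow> \<forall>A\<in>M. CA A a \<in> closure_abox \<T> \<A> \<Longrightarrow> entails_concept \<T> M B \<Longrightarrow>
    CA B a \<in> closure_abox \<T> \<A>"
| forall_ax: "ForallSub X r (Name B) \<in> \<T> \<Longrightarrow> has (closure_abox \<T> \<A>) X a \<Longrightarrow>
    role_assertion r a b \<in> closure_abox \<T> \<A> \<Longrightarrow> CA B b \<in> closure_abox \<T> \<A>"
| role_incl: "entails_role \<T> r s \<Longrightarrow> role_assertion r a b \<in> closure_abox \<T> \<A> \<Longrightarrow>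
    role_assertion s a b \<in> closure_abox \<T> \<A>"
| merge_concept: "AtMostOne X r Y \<in> \<T> \<Longrightarrow> has (closure_abox \<T> \<A>) X a \<Longrightarrow>
    role_assertion r a b \<in> closure_abox \<T> \<A> \<Longrightarrow> has (closure_abox \<T> \<A>) Y b \<Longrightarrow>
    \<forall>A\<in>M. CA A a \<in> closure_abox \<T> \<A> \<Longrightarrow> entails_ex \<T> M R N \<Longrightarrow>
    r \<in> R \<Longrightarrow> Y \<in> insert Top (Name ` N) \<Longrightarrow> B \<in> N \<Longrightarrow> CA B b \<in> closure_abox \<T> \<A>"
| merge_role: "AtMostOne X r Y \<in> \<T> \<Longrightarrow> has (closure_abox \<T> \<A>) X a \<Longrightarrow>
    role_assertion r a b \<in> closure_abox \<T> \<A> \<Longrightarrow> has (closure_abox \<T> \<A>) Y b \<Longrightarrow>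
    \<forall>A\<in>M. CA A a \<in> closure_abox \<T> \<A> \<Longrightarrow> entails_ex \<T> M R N \<Longrightarrow>
    r \<in> R \<Longrightarrow> Y \<in> insert Top (Name ` N) \<Longrightarrow> s \<in> R \<Longrightarrow>
    role_assertion s a b \<in> closure_abox \<T> \<A>"
  monos has_mono

definition concepts_of :: "('i, 'c, 'r) assertion set \<Rightarrow> 'i \<Rightarrow> 'c set" where
  "concepts_of \<A> a = {A. CA A a \<in> \<A>}"

definition roles_between :: "('i, 'c, 'r) assertion set \<Rightarrow> 'i \<Rightarrow> 'i \<Rightarrow> 'r role set" where
  "roles_between \<A> a b = {r. role_assertion r a b \<in> \<A>}"

definition ind_types :: "('i, 'c, 'r) assertion set \<Rightarrow> 'i \<Rightarrow> ('c, 'r) type2 set" where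
  "ind_types \<A> a = insert (concepts_of \<A> a, {}, {})
     {(concepts_of \<A> a, roles_between \<A> a b, concepts_of \<A> b) | b. roles_between \<A> a b \<noteq> {}}"


section \<open>The austere canonical model\<close>

text \<open>The word \<open>a k\<^sub>1 \<dots> k\<^sub>n\<close> is \<open>(a, [k\<^sub>1, \<dots>, k\<^sub>n])\<close>, the individual
  \<open>a\<close> itself being \<open>(a, [])\<close>.\<close>

type_synonym ('i, 'c, 'r) word = "'i \<times> ('c, 'r) type2 list"

definition can_universe :: "('c, 'r) tbox_axiom set \<Rightarrow> ('i, 'c, 'r) assertion set \<Rightarrow>
    ('i, 'c, 'r) word set" where
  "can_universe \<T> \<A> = {(a, ks). a \<in> inds \<A> \<and>
     (ks \<noteq> [] \<longrightarrow> pi1 (hd ks) = concepts_of (closure_abox \<T> \<A>) a \<and>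
        (pi2 (hd ks), pi3 (hd ks)) \<in> succ_config \<T> (ind_types (closure_abox \<T> \<A>) a)) \<and>
     (\<forall>i. Suc i < length ks \<longrightarrow> child \<T> (ks ! i) (ks ! Suc i))}"

definition can :: "('c, 'r) tbox_axiom set \<Rightarrow> ('i, 'c, 'r) assertion set \<Rightarrow>
    (('i, 'c, 'r) word, 'c, 'r, 'i) ind_interp" where
  "can \<T> \<A> = \<lparr>
     universe = can_universe \<T> \<A>,
     cext = (\<lambda>A. {(a, []) | a. CA A a \<in> closure_abox \<T> \<A>} \<union>
       {(a, ks) | a ks. (a, ks) \<in> can_universe \<T> \<A> \<and> ks \<noteq> [] \<and> A \<in> pi3 (last ks)}),
     rext = (\<lambda>r. {((a, []), (b, [])) | a b. RA r a b \<in> closure_abox \<T> \<A>} \<union>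
       {((a, ks), (a, ks @ [k])) | a ks k.
          (a, ks @ [k]) \<in> can_universe \<T> \<A> \<and> Role r \<in> pi2 k} \<union>
       {((a, ks @ [k]), (a, ks)) | a ks k.
          (a, ks @ [k]) \<in> can_universe \<T> \<A> \<and> Inv r \<in> pi2 k}),
     den = (\<lambda>a. (a, []))\<rparr>"


section \<open>Entailment does not depend on the type of the domain\<close>

lemma countable_submodel:
  fixes I :: "('d, 'c, 'r, 'z) interp_scheme"
  assumes T: "countable \<T>" and I: "sat_tbox I \<T>" and e: "e \<in> universe I" and f: "f \<in> universe I"
  obtains D where "countable D" "D \<subseteq> universe I" "e \<in> D" "f \<in> D"
    "\<And>X r Y d. ExistsSub X r Y \<in> \<T> \<Longrightarrow> d \<in> D \<Longrightarrow> d \<in> basic_ext I X \<Longrightarrow>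
       \<exists>d'\<in>D. d' \<in> basic_ext I Y \<and> (d, d') \<in> role_ext I r"
proof -
  have sub: "basic_ext I Y \<subseteq> universe I" for Y
    using I by (cases Y) (auto simp: sat_tbox_def is_interp_def)
  define good where "good \<tau> d d' \<longleftrightarrow> d' \<in> universe I \<and>
    (\<exists>X r Y. \<tau> = ExistsSub X r Y \<and> d' \<in> basic_ext I Y \<and> (d, d') \<in> role_ext I r)" for \<tau> d d'
  define wit where "wit = (\<lambda>(\<tau>, d). if Ex (good \<tau> d) then SOME d'. good \<tau> d d' else d)"
  have wit_good: "good \<tau> d (wit (\<tau>, d))" if "good \<tau> d d'" for \<tau> d d'
    using someI[of "good \<tau> d", OF that] that by (auto simp: wit_def)
  have wit_univ: "wit (\<tau>, d) \<in> universe I" if "d \<in> universe I" for \<tau> d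
  proof (cases "Ex (good \<tau> d)")
    case True
    then obtain d' where "good \<tau> d d'" by blast
    then show ?thesis using wit_good unfolding good_def by blast
  next
    case False
    then show ?thesis using that by (auto simp: wit_def)
  qed
  define S where "S n = ((\<lambda>D. D \<union> wit ` (\<T> \<times> D)) ^^ n) {e, f}" for n
  have S0: "S 0 = {e, f}" and SS: "S (Suc n) = S n \<union> wit ` (\<T> \<times> S n)" for n
    by (simp_all add: S_def)
  have cS: "countable (S n)" for n
    by (induction n) (simp_all add: S0 SS T)
  have uS: "S n \<subseteq> universe I" for n
  proof (induction n)
    case 0 then show ?case using e f by (simp add: S0)
  next
    case (Suc n) then show ?case by (auto simp: SS intro: wit_univ)
  qed
  show thesis
  proof (rule that[of "\<Union>n. S n"])
    show "countable (\<Union>n. S n)" using cS by simp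
    show "(\<Union>n. S n) \<subseteq> universe I" using uS by blast
    show "e \<in> (\<Union>n. S n)" "f \<in> (\<Union>n. S n)" using S0 by blast+
    fix X r Y d
    assume ax: "ExistsSub X r Y \<in> \<T>" and d: "d \<in> (\<Union>n. S n)" and dX: "d \<in> basic_ext I X"
    from d obtain n where n: "d \<in> S n" by blast
    have "sat_axiom I (ExistsSub X r Y)" using I ax by (auto simp: sat_tbox_def)
    then obtain d' where "d' \<in> basic_ext I Y" "(d, d') \<in> role_ext I r" using dX by auto
    then have "good (ExistsSub X r Y) d d'" using sub by (auto simp: good_def)
    then have "good (ExistsSub X r Y) d (wit (ExistsSub X r Y, d))" by (rule wit_good)
    moreover have "wit (ExistsSub X r Y, d) \<in> S (Suc n)" using ax n by (auto simp: SS)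
    ultimately show "\<exists>d'\<in>\<Union>n. S n. d' \<in> basic_ext I Y \<and> (d, d') \<in> role_ext I r"
      by (auto simp: good_def)
  qed
qed

lemma nat_submodel:
  fixes I :: "('d, 'c, 'r, 'z) interp_scheme"
  assumes T: "countable \<T>" and I: "sat_tbox I \<T>" and e: "e \<in> universe I" and f: "f \<in> universe I"
  obtains J :: "(nat, 'c, 'r) interp" and D and g :: "'d \<Rightarrow> nat" where
    "sat_tbox J \<T>" "inj_on g D" "D \<subseteq> universe I" "e \<in> D" "f \<in> D" "universe J = g ` D"
    "\<And>A. cext J A = g ` (cext I A \<inter> D)"
    "\<And>r. rext J r = map_prod g g ` (rext I r \<inter> D \<times> D)"
proof -
  obtain D where D: "countable D" "D \<subseteq> universe I" "e \<in> D" "f \<in> D"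
    and wit: "\<And>X r Y d. ExistsSub X r Y \<in> \<T> \<Longrightarrow> d \<in> D \<Longrightarrow> d \<in> basic_ext I X \<Longrightarrow>
       \<exists>d'\<in>D. d' \<in> basic_ext I Y \<and> (d, d') \<in> role_ext I r"
    using countable_submodel[OF T I e f] by blast
  define g where "g = to_nat_on D"
  have inj: "inj_on g D" using D(1) by (simp add: g_def inj_on_to_nat_on)
  define J :: "(nat, 'c, 'r) interp" where
    "J = \<lparr>universe = g ` D, cext = (\<lambda>A. g ` (cext I A \<inter> D)),
          rext = (\<lambda>r. map_prod g g ` (rext I r \<inter> D \<times> D))\<rparr>"
  have U: "universe J = g ` D" by (simp add: J_def)
  have B: "basic_ext J X = g ` (basic_ext I X \<inter> D)" for X
    using D(2) by (cases X) (auto simp: J_def)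
  have R: "role_ext J r = map_prod g g ` (role_ext I r \<inter> D \<times> D)" for r
    by (cases r) (force simp: J_def)+
  have geq: "g x = g y \<longleftrightarrow> x = y" if "x \<in> D" "y \<in> D" for x y
    using inj that by (auto dest: inj_onD)
  have Bin: "g d \<in> basic_ext J X \<longleftrightarrow> d \<in> basic_ext I X" if "d \<in> D" for d X
    using that geq by (auto simp: B)
  have Rin: "(g d, g d') \<in> role_ext J r \<longleftrightarrow> (d, d') \<in> role_ext I r" if "d \<in> D" "d' \<in> D" for d d' r
    using that geq by (auto simp: R)
  have Bout: "\<exists>d\<in>D. x = g d \<and> d \<in> basic_ext I X" if "x \<in> basic_ext J X" for x X
    using that by (auto simp: B)
  have Rout: "\<exists>d\<in>D. \<exists>d'\<in>D. x = g d \<and> y = g d' \<and> (d, d') \<in> role_ext I r"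
    if "(x, y) \<in> role_ext J r" for x y r
    using that by (auto simp: R)
  have "is_interp J" using D(3) by (auto simp: is_interp_def J_def)
  moreover have "sat_axiom J \<tau>" if \<tau>: "\<tau> \<in> \<T>" for \<tau>
  proof -
    have s: "sat_axiom I \<tau>" using I \<tau> by (auto simp: sat_tbox_def)
    show ?thesis
    proof (cases \<tau>)
      case (ConjSub As B)
      have "x \<in> basic_ext J B" if "x \<in> universe J" "\<forall>A\<in>set As. x \<in> basic_ext J A" for x
      proof -
        obtain d where d: "d \<in> D" "x = g d" using \<open>x \<in> universe J\<close> U by auto
        then have "\<forall>A\<in>set As. d \<in> basic_ext I A" using that(2) Bin by simp
        then have "d \<in> basic_ext I B" using s ConjSub d D(2) by auto
        then show ?thesis using d Bin by simp
      qed
      then show ?thesis using ConjSub by auto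
    next
      case (AtMostOne X r Y)
      have u: "a = b" if "x \<in> basic_ext I X" "a \<in> basic_ext I Y" "b \<in> basic_ext I Y"
        "(x, a) \<in> role_ext I r" "(x, b) \<in> role_ext I r" for x a b
        using s AtMostOne that by auto
      have "a = b" if "x \<in> basic_ext J X" "a \<in> basic_ext J Y" "b \<in> basic_ext J Y"
        "(x, a) \<in> role_ext J r" "(x, b) \<in> role_ext J r" for x a b
        using Bout[OF that(1)] Bout[OF that(2)] Bout[OF that(3)] that(4,5) u Rin by metis
      then show ?thesis using AtMostOne by auto
    next
      case (ForallSub X r Y)
      have u: "a \<in> basic_ext I Y" if "x \<in> basic_ext I X" "(x, a) \<in> role_ext I r" for x a
        using s ForallSub that by auto
      have "a \<in> basic_ext J Y" if "x \<in> basic_ext J X" "(x, a) \<in> role_ext J r" for x a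
        using Rout[OF that(2)] that(1) u Bin by metis
      then show ?thesis using ForallSub by auto
    next
      case (ExistsSub X r Y)
      have "\<exists>a\<in>basic_ext J Y. (x, a) \<in> role_ext J r" if "x \<in> basic_ext J X" for x
        using Bout[OF that] wit[of X r Y] \<tau> ExistsSub Bin Rin by metis
      then show ?thesis using ExistsSub by auto
    next
      case (RoleSub r s')
      then show ?thesis using s by (auto simp: R)
    qed
  qed
  ultimately have "sat_tbox J \<T>" by (simp add: sat_tbox_def)
  then show thesis
    by (rule that[of J g D]) (use inj D in \<open>simp_all add: J_def\<close>)
qed

lemma entails_concept_any_type:
  fixes I :: "('d, 'c, 'r, 'z) interp_scheme"
  assumes T: "countable \<T>" and ent: "entails_concept \<T> M B" and I: "sat_tbox I \<T>"
  shows "conj_ext I M \<subseteq> cext I B"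
proof
  fix e assume e: "e \<in> conj_ext I M"
  then have eu: "e \<in> universe I" by (simp add: conj_ext_def)
  obtain J :: "(nat, 'c, 'r) interp" and D and g :: "'d \<Rightarrow> nat" where
    J: "sat_tbox J \<T>" "inj_on g D" "D \<subseteq> universe I" "e \<in> D" "universe J = g ` D"
    "\<And>A. cext J A = g ` (cext I A \<inter> D)"
    using nat_submodel[OF T I eu eu] by metis
  have "g e \<in> conj_ext J M" using e J by (auto simp: conj_ext_def)
  then have "g e \<in> cext J B" using ent J(1) by (auto simp: entails_concept_def)
  then show "e \<in> cext I B" using J by (auto dest: inj_onD)
qed

lemma entails_role_any_type:
  fixes I :: "('d, 'c, 'r, 'z) interp_scheme"
  assumes T: "countable \<T>" and ent: "entails_role \<T> r s" and I: "sat_tbox I \<T>"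
  shows "role_ext I r \<subseteq> role_ext I s"
proof (rule subrelI)
  fix e f assume ef: "(e, f) \<in> role_ext I r"
  then have eu: "e \<in> universe I" "f \<in> universe I"
    using I by (cases r; fastforce simp: sat_tbox_def is_interp_def)+
  obtain J :: "(nat, 'c, 'r) interp" and D and g :: "'d \<Rightarrow> nat" where
    J: "sat_tbox J \<T>" "inj_on g D" "e \<in> D" "f \<in> D"
    "\<And>r. rext J r = map_prod g g ` (rext I r \<inter> D \<times> D)"
    using nat_submodel[OF T I eu] by metis
  have R: "(g e, g f) \<in> role_ext J q \<longleftrightarrow> (e, f) \<in> role_ext I q" for q
    using J(2-4) by (cases q) (auto simp: J(5) dest: inj_onD)
  show "(e, f) \<in> role_ext I s" using ent J(1) ef R unfolding entails_role_def by blast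
qed

lemma entails_ex_any_type:
  fixes I :: "('d, 'c, 'r, 'z) interp_scheme"
  assumes T: "countable \<T>" and ent: "entails_ex \<T> M R N" and I: "sat_tbox I \<T>"
  shows "conj_ext I M \<subseteq> ex_ext I R N"
proof
  fix e assume e: "e \<in> conj_ext I M"
  then have eu: "e \<in> universe I" by (simp add: conj_ext_def)
  obtain J :: "(nat, 'c, 'r) interp" and D and g :: "'d \<Rightarrow> nat" where
    J: "sat_tbox J \<T>" "inj_on g D" "D \<subseteq> universe I" "e \<in> D" "universe J = g ` D"
    "\<And>A. cext J A = g ` (cext I A \<inter> D)"
    "\<And>r. rext J r = map_prod g g ` (rext I r \<inter> D \<times> D)"
    using nat_submodel[OF T I eu eu] by metis
  have "g e \<in> conj_ext J M" using e J by (auto simp: conj_ext_def)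
  then have "g e \<in> ex_ext J R N" using ent J(1) by (auto simp: entails_ex_def)
  then obtain f where f: "f \<in> conj_ext J N" "\<And>r. r \<in> R \<Longrightarrow> (g e, f) \<in> role_ext J r"
    by (auto simp: ex_ext_def)
  obtain d where d: "d \<in> D" "f = g d" using f(1) J(5) by (auto simp: conj_ext_def)
  have "(e, d) \<in> role_ext I r" if "r \<in> R" for r
    using f(2)[OF that] d J(2,4) by (cases r) (auto simp: J(7) dest: inj_onD)
  moreover have "d \<in> conj_ext I N"
    using f(1) d J(2,3) by (auto simp: conj_ext_def J(6) dest: inj_onD)
  ultimately show "e \<in> ex_ext I R N" using eu by (auto simp: ex_ext_def)
qed

end

(*
  A reduct of some model of the knowledge base to its finite signature bounds the 1 1/2-types entailed by
  the concepts of a word, so the good successor configuration consists of the maximal uncovered ones.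
  Maximality makes the types on a word closed under the consequences of the TBox, which gives the
  model property; following entailed witnesses gives a homomorphism into any model, and Bot and the
  standard names are handled by the homomorphism into that one model.  An endomorphism of the
  canonical model is the identity: it fixes a word w, maps a child of w to a neighbour of w with a
  larger type, R4 excludes neighbours other than children and R3 excludes other children.  Rigidity
  yields both the core property and uniqueness.
*)
theory Submission
  imports Defs "HOL-Library.Product_Order"
begin

section \<open>Inverse roles, basic concepts and homomorphisms\<close>

lemma rinv_rinv [simp]: "rinv (rinv r) = r"
  by (cases r) auto

lemma rinv_image_iff [simp]: "r \<in> rinv ` R \<longleftrightarrow> rinv r \<in> R"
  by (metis image_iff rinv_rinv)

lemma role_ext_rinv [simp]: "(x, y) \<in> role_ext I (rinv r) \<longleftrightarrow> (y, x) \<in> role_ext I r"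
  by (cases r) auto

lemma role_assertion_rinv [simp]: "role_assertion (rinv r) a b = role_assertion r b a"
  by (cases r) auto

lemma sat_role_assertion [simp]:
  "sat_assertion I (role_assertion r a b) \<longleftrightarrow> (den I a, den I b) \<in> role_ext I r"
  by (cases r) auto

lemma assertion_inds_role_assertion [simp]: "assertion_inds (role_assertion r a b) = {a, b}"
  by (cases r) auto

lemma sat_tboxD: "sat_tbox I \<T> \<Longrightarrow> \<tau> \<in> \<T> \<Longrightarrow> sat_axiom I \<tau>"
  by (simp add: sat_tbox_def)

lemma basic_ext_universe: "is_interp I \<Longrightarrow> basic_ext I X \<subseteq> universe I"
  by (cases X) (auto simp: is_interp_def)

lemma role_ext_universe: "is_interp I \<Longrightarrow> role_ext I r \<subseteq> universe I \<times> universe I"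
  by (cases r) (auto simp: is_interp_def)

text \<open>These are the basic concepts that membership in all names of \<open>M\<close> guarantees
  syntactically; \<open>Bot\<close> is left out. Side conditions of TBox axioms can thus be tested
  on label sets.\<close>

abbreviation basics :: "'c set \<Rightarrow> 'c basic set" where
  "basics M \<equiv> insert Top (Name ` M)"

lemma conj_ext_basic: "e \<in> conj_ext I M \<Longrightarrow> X \<in> basics M \<Longrightarrow> e \<in> basic_ext I X"
  by (auto simp: conj_ext_def)

lemma conj_ext_Un: "e \<in> conj_ext I (M \<union> N) \<longleftrightarrow> e \<in> conj_ext I M \<and> e \<in> conj_ext I N"
  by (auto simp: conj_ext_def)

lemma has_iff: "has \<A> X a \<longleftrightarrow> X \<in> basics (concepts_of \<A> a)"
  by (auto simp: has_def concepts_of_def)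

lemma homomorphism_role:
  assumes "homomorphism X h I J" "is_interp I" "(e, f) \<in> role_ext I r"
  shows "(h e, h f) \<in> role_ext J r"
proof -
  have "e \<in> universe I" "f \<in> universe I" using role_ext_universe[OF assms(2)] assms(3) by blast+
  then show ?thesis using assms(1,3) by (cases r) (simp_all add: homomorphism_def)
qed

lemma homomorphism_basic:
  assumes "homomorphism X h I J" "is_interp I" "e \<in> basic_ext I Y"
  shows "h e \<in> basic_ext J Y"
proof -
  have "e \<in> universe I" using basic_ext_universe[OF assms(2)] assms(3) by blast
  then show ?thesis using assms(1,3) by (cases Y) (auto simp: homomorphism_def)
qed


section \<open>Entailed existential restrictions\<close>

lemma entails_exI:
  fixes \<T> :: "('c, 'r) tbox_axiom set"
  assumes "R \<noteq> {}"
    and "\<And>(I :: (nat, 'c, 'r) interp) e. is_interp I \<Longrightarrow> sat_tbox I \<T> \<Longrightarrow> e \<in> conj_ext I M \<Longrightarrow>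
      \<exists>f\<in>conj_ext I N. \<forall>r\<in>R. (e, f) \<in> role_ext I r"
  shows "entails_ex \<T> M R N"
  using assms by (fastforce simp: entails_ex_def ex_ext_def sat_tbox_def conj_ext_def)

lemma entails_exE:
  assumes "entails_ex \<T> M R N" "sat_tbox (I :: (nat, 'c, 'r) interp) \<T>" "e \<in> conj_ext I M"
  obtains f where "f \<in> conj_ext I N" "\<And>r. r \<in> R \<Longrightarrow> (e, f) \<in> role_ext I r"
  using assms by (fastforce simp: entails_ex_def ex_ext_def)

lemma entails_ex_nonempty: "entails_ex \<T> M R N \<Longrightarrow> R \<noteq> {}"
  by (simp add: entails_ex_def)

lemma entails_ex_mono:
  fixes \<T> :: "('c, 'r) tbox_axiom set"
  assumes "entails_ex \<T> M R N" "M \<subseteq> M'"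
  shows "entails_ex \<T> M' R N"
proof -
  have "conj_ext I M' \<subseteq> conj_ext I M" for I :: "(nat, 'c, 'r) interp"
    using assms(2) by (auto simp: conj_ext_def)
  then show ?thesis using assms(1) unfolding entails_ex_def by blast
qed

text \<open>\<open>Top\<close> and \<open>Bot\<close> as fillers both become the empty set of names.
  For \<open>Bot\<close> this is only a weakening; the canonical model rules out that case
  separately.\<close>

lemma entails_ex_axiom:
  fixes \<T> :: "('c, 'r) tbox_axiom set"
  assumes "ExistsSub X r Y \<in> \<T>" "X \<in> basics M"
  shows "entails_ex \<T> M {r} (case Y of Name B \<Rightarrow> {B} | _ \<Rightarrow> {})"
proof (rule entails_exI)
  fix I :: "(nat, 'c, 'r) interp" and e
  assume I: "is_interp I" "sat_tbox I \<T>" and e: "e \<in> conj_ext I M"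
  obtain f where f: "f \<in> basic_ext I Y" "(e, f) \<in> role_ext I r"
    using sat_tboxD[OF I(2) assms(1)] conj_ext_basic[OF e assms(2)] by auto
  have "f \<in> universe I" using basic_ext_universe[OF I(1)] f(1) by blast
  then show "\<exists>f\<in>conj_ext I (case Y of Name B \<Rightarrow> {B} | _ \<Rightarrow> {}). \<forall>r\<in>{r}. (e, f) \<in> role_ext I r"
    using f by (intro bexI[of _ f]) (auto simp: conj_ext_def split: basic.split)
qed simp

text \<open>The axiom applies to the witness itself. The point is the enlarged set of names: since
  successor types are maximal, it later forces \<open>B\<close> into the successor.\<close>

lemma entails_ex_forall:
  fixes \<T> :: "('c, 'r) tbox_axiom set"
  assumes ex: "entails_ex \<T> M R N" and ax: "ForallSub X r (Name B) \<in> \<T>"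
    and X: "X \<in> basics M" and r: "r \<in> R"
  shows "entails_ex \<T> M R (insert B N)"
proof (rule entails_exI)
  fix I :: "(nat, 'c, 'r) interp" and e
  assume I: "is_interp I" "sat_tbox I \<T>" and e: "e \<in> conj_ext I M"
  obtain f where f: "f \<in> conj_ext I N" "\<And>r. r \<in> R \<Longrightarrow> (e, f) \<in> role_ext I r"
    using entails_exE[OF ex I(2) e] by blast
  have "f \<in> cext I B"
    using sat_tboxD[OF I(2) ax] conj_ext_basic[OF e X] f(2)[OF r] by auto
  then show "\<exists>f\<in>conj_ext I (insert B N). \<forall>r\<in>R. (e, f) \<in> role_ext I r"
    using f by (intro bexI[of _ f]) (auto simp: conj_ext_def)
qed (rule entails_ex_nonempty[OF ex])

text \<open>The axiom fires at the witness \<open>f\<close>, whose \<open>r\<close>-successor is the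
  starting element \<open>e\<close>, because \<open>rinv r\<close> leads from \<open>e\<close> to
  \<open>f\<close>.\<close>

lemma entails_concept_forall_back:
  fixes \<T> :: "('c, 'r) tbox_axiom set"
  assumes ex: "entails_ex \<T> M R N" and ax: "ForallSub X r (Name B) \<in> \<T>"
    and X: "X \<in> basics N" and r: "rinv r \<in> R"
  shows "entails_concept \<T> M B"
  unfolding entails_concept_def
proof (intro allI impI subsetI)
  fix I :: "(nat, 'c, 'r) interp" and e
  assume I: "sat_tbox I \<T>" and e: "e \<in> conj_ext I M"
  obtain f where f: "f \<in> conj_ext I N" "\<And>r. r \<in> R \<Longrightarrow> (e, f) \<in> role_ext I r"
    using entails_exE[OF ex I e] by blast
  show "e \<in> cext I B"
    using sat_tboxD[OF I ax] conj_ext_basic[OF f(1) X] f(2)[OF r] by auto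
qed

lemma entails_ex_role:
  fixes \<T> :: "('c, 'r) tbox_axiom set"
  assumes ex: "entails_ex \<T> M R N" and rs: "entails_role \<T> r s" "r \<in> R"
  shows "entails_ex \<T> M (insert s R) N"
proof (rule entails_exI)
  fix I :: "(nat, 'c, 'r) interp" and e
  assume I: "is_interp I" "sat_tbox I \<T>" and e: "e \<in> conj_ext I M"
  obtain f where f: "f \<in> conj_ext I N" "\<And>r. r \<in> R \<Longrightarrow> (e, f) \<in> role_ext I r"
    using entails_exE[OF ex I(2) e] by blast
  then show "\<exists>f\<in>conj_ext I N. \<forall>r\<in>insert s R. (e, f) \<in> role_ext I r"
    using rs I(2) by (intro bexI[of _ f]) (auto simp: entails_role_def)
qed simp

lemma entails_ex_concept:
  fixes \<T> :: "('c, 'r) tbox_axiom set"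
  assumes ex: "entails_ex \<T> M R N" and B: "entails_concept \<T> N B"
  shows "entails_ex \<T> M R (insert B N)"
proof (rule entails_exI)
  fix I :: "(nat, 'c, 'r) interp" and e
  assume I: "is_interp I" "sat_tbox I \<T>" and e: "e \<in> conj_ext I M"
  obtain f where f: "f \<in> conj_ext I N" "\<And>r. r \<in> R \<Longrightarrow> (e, f) \<in> role_ext I r"
    using entails_exE[OF ex I(2) e] by blast
  then have "f \<in> cext I B" using B I(2) by (auto simp: entails_concept_def)
  then show "\<exists>f\<in>conj_ext I (insert B N). \<forall>r\<in>R. (e, f) \<in> role_ext I r"
    using f by (intro bexI[of _ f]) (auto simp: conj_ext_def)
qed (rule entails_ex_nonempty[OF ex])

text \<open>Both witnesses are \<open>r\<close>-successors of \<open>e\<close> lying in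
  \<open>Y\<close>, so the functionality axiom makes them equal and one element carries both
  types.\<close>

lemma entails_ex_merge:
  fixes \<T> :: "('c, 'r) tbox_axiom set"
  assumes ex: "entails_ex \<T> M R N" and ex': "entails_ex \<T> M R' N'"
    and ax: "AtMostOne X r Y \<in> \<T>" and X: "X \<in> basics M"
    and r: "r \<in> R" "r \<in> R'" and Y: "Y \<in> basics N" "Y \<in> basics N'"
  shows "entails_ex \<T> M (R \<union> R') (N \<union> N')"
proof (rule entails_exI)
  fix I :: "(nat, 'c, 'r) interp" and e
  assume I: "is_interp I" "sat_tbox I \<T>" and e: "e \<in> conj_ext I M"
  obtain f where f: "f \<in> conj_ext I N" "\<And>r. r \<in> R \<Longrightarrow> (e, f) \<in> role_ext I r"
    using entails_exE[OF ex I(2) e] by blast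
  obtain g where g: "g \<in> conj_ext I N'" "\<And>r. r \<in> R' \<Longrightarrow> (e, g) \<in> role_ext I r"
    using entails_exE[OF ex' I(2) e] by blast
  have "f = g"
    using sat_tboxD[OF I(2) ax] conj_ext_basic[OF e X] f(2)[OF r(1)] g(2)[OF r(2)]
      conj_ext_basic[OF f(1) Y(1)] conj_ext_basic[OF g(1) Y(2)] by auto
  then show "\<exists>f\<in>conj_ext I (N \<union> N'). \<forall>r\<in>R \<union> R'. (e, f) \<in> role_ext I r"
    using f g by (intro bexI[of _ f]) (auto simp: conj_ext_Un)
qed (use r in auto)

text \<open>Functionality is used at the witness \<open>f\<close> of the first restriction:
  \<open>e\<close> and the witness \<open>g\<close> of the second one are both
  \<open>r\<close>-successors of \<open>f\<close> in \<open>Y\<close>, hence equal. So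
  \<open>e\<close> inherits \<open>N'\<close>, and the roles \<open>R'\<close> from \<open>f\<close>
  to \<open>g\<close> become inverse roles from \<open>e\<close> to \<open>f\<close>.\<close>

lemma entails_merge_back:
  fixes \<T> :: "('c, 'r) tbox_axiom set"
  assumes ex: "entails_ex \<T> M R N" and ex': "entails_ex \<T> N R' N'"
    and ax: "AtMostOne X r Y \<in> \<T>" and X: "X \<in> basics N"
    and r: "rinv r \<in> R" "r \<in> R'" and Y: "Y \<in> basics M" "Y \<in> basics N'"
  shows "B \<in> N' \<Longrightarrow> entails_concept \<T> M B" and "entails_ex \<T> M (R \<union> rinv ` R') N"
proof -
  have *: "\<exists>f\<in>conj_ext I N. (\<forall>r\<in>R \<union> rinv ` R'. (e, f) \<in> role_ext I r) \<and> e \<in> conj_ext I N'"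
    if I: "sat_tbox I \<T>" and e: "e \<in> conj_ext I M" for I :: "(nat, 'c, 'r) interp" and e
  proof -
    obtain f where f: "f \<in> conj_ext I N" "\<And>r. r \<in> R \<Longrightarrow> (e, f) \<in> role_ext I r"
      using entails_exE[OF ex I e] by blast
    obtain g where g: "g \<in> conj_ext I N'" "\<And>r. r \<in> R' \<Longrightarrow> (f, g) \<in> role_ext I r"
      using entails_exE[OF ex' I f(1)] by blast
    have "e = g"
      using sat_tboxD[OF I ax] conj_ext_basic[OF e Y(1)] f(2)[OF r(1)] g(2)[OF r(2)]
        conj_ext_basic[OF f(1) X] conj_ext_basic[OF g(1) Y(2)] by auto
    then show ?thesis using f g by (intro bexI[of _ f]) auto
  qed
  show "entails_concept \<T> M B" if "B \<in> N'"
    using * that unfolding entails_concept_def conj_ext_def by blast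
  show "entails_ex \<T> M (R \<union> rinv ` R') N"
    by (rule entails_exI) (use * r in blast)+
qed


section \<open>Soundness of the completed ABox\<close>

lemma entails_ex_witness:
  fixes I :: "('d, 'c, 'r, 'z) interp_scheme"
  assumes "countable \<T>" "entails_ex \<T> M R N" "sat_tbox I \<T>" "e \<in> conj_ext I M"
  shows "\<exists>f\<in>conj_ext I N. \<forall>r\<in>R. (e, f) \<in> role_ext I r"
  using entails_ex_any_type[OF assms(1-3)] assms(4) by (auto simp: ex_ext_def)

text \<open>Rule induction on the closure. Tracking the individuals along the way keeps every
  denotation inside the domain of \<open>J\<close>.\<close>

lemma closure_abox_sound:
  fixes J :: "('e, 'c, 'r, 'i) ind_interp"
  assumes T: "countable \<T>" and J: "is_model J \<T> \<A>" and \<alpha>: "\<alpha> \<in> closure_abox \<T> \<A>"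
  shows "sat_assertion J \<alpha> \<and> assertion_inds \<alpha> \<subseteq> inds \<A>"
proof -
  have st: "sat_tbox J \<T>" and du: "\<And>a. a \<in> inds \<A> \<Longrightarrow> den J a \<in> universe J"
    using J by (auto simp: is_model_def)
  \<comment> \<open>The set in the premise is the form in which the induction hypothesis supplies
    \<open>has\<close>: derived assertions already known to be sound.\<close>
  have hasD: "den J a \<in> basic_ext J X"
    if "has {\<beta>. \<beta> \<in> closure_abox \<T> \<A> \<and> sat_assertion J \<beta> \<and> assertion_inds \<beta> \<subseteq> inds \<A>} X a"
      "a \<in> inds \<A>" for X a
    using that du by (auto simp: has_def)
  \<comment> \<open>The entailed witness of \<open>a\<close> and the named neighbour
    \<open>b\<close> compete for the single \<open>r\<close>-successor in \<open>Y\<close>, so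
    \<open>b\<close> itself carries the entailed type.\<close>
  have merge: "den J b \<in> conj_ext J N \<and> (\<forall>s\<in>R. (den J a, den J b) \<in> role_ext J s)"
    if ax: "AtMostOne X r Y \<in> \<T>" and X: "den J a \<in> basic_ext J X" and Y: "den J b \<in> basic_ext J Y"
      and M: "den J a \<in> conj_ext J M" and ex: "entails_ex \<T> M R N" and r: "r \<in> R"
      and YN: "Y \<in> basics N" and ab: "(den J a, den J b) \<in> role_ext J r" for X r Y a b M R N
  proof -
    obtain f where f: "f \<in> conj_ext J N" "\<And>r. r \<in> R \<Longrightarrow> (den J a, f) \<in> role_ext J r"
      using entails_ex_witness[OF T ex st M] by blast
    have "f = den J b"
      using sat_tboxD[OF st ax] X Y ab f(2)[OF r] conj_ext_basic[OF f(1) YN] by auto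
    then show ?thesis using f by auto
  qed
  show ?thesis using \<alpha>
  proof induction
    case (assertion \<alpha>)
    then show ?case using J by (auto simp: is_model_def inds_def)
  next
    case (conj_incl a M B)
    then have "den J a \<in> conj_ext J M" using du by (auto simp: conj_ext_def)
    then show ?case using entails_concept_any_type[OF T conj_incl.hyps(2) st] conj_incl by auto
  next
    case (forall_ax X r B a b)
    then show ?case using sat_tboxD[OF st forall_ax.hyps(1)] hasD[of X a] by auto
  next
    case (role_incl r s a b)
    then show ?case using entails_role_any_type[OF T role_incl.hyps(1) st] by auto
  next
    case (merge_concept X r Y a b M R N B)
    then have "den J a \<in> conj_ext J M" using du by (auto simp: conj_ext_def)
    then show ?case
      using merge[of X r Y a b M R N] merge_concept hasD[of X a] hasD[of Y b]
      by (auto simp: conj_ext_def)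
  next
    case (merge_role X r Y a b M R N s)
    then have "den J a \<in> conj_ext J M" using du by (auto simp: conj_ext_def)
    then show ?case
      using merge[of X r Y a b M R N] merge_role hasD[of X a] hasD[of Y b] by auto
  qed
qed


section \<open>Models of finite signature\<close>

lemma finite_set_basic: "finite (set_basic X)"
  by (cases X) auto

lemma finite_set_role: "finite (set_role r)"
  by (cases r) auto

lemma finite_set1_tbox_axiom: "finite (set1_tbox_axiom \<tau>)"
  by (cases \<tau>) (auto simp: finite_set_basic)

lemma finite_set2_tbox_axiom: "finite (set2_tbox_axiom \<tau>)"
  by (cases \<tau>) (auto simp: finite_set_role)

lemma finite_set2_assertion: "finite (set2_assertion \<alpha>)"
  by (cases \<alpha>) auto

lemma finite_set3_assertion: "finite (set3_assertion \<alpha>)"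
  by (cases \<alpha>) auto

text \<open>Names that are foreign to the knowledge base can be emptied in a model of it.\<close>

lemma finite_signature_model:
  fixes \<T> :: "('c, 'r) tbox_axiom set" and \<A> :: "('i, 'c, 'r) assertion set"
  assumes fin: "finite \<T>" "finite \<A>" and "consistent TYPE('d) \<T> \<A>"
  obtains I :: "('d, 'c, 'r, 'i) ind_interp" where "is_model I \<T> \<A>"
    "finite {A. cext I A \<noteq> {}}" "finite {r. rext I r \<noteq> {}}"
proof -
  obtain I :: "('d, 'c, 'r, 'i) ind_interp" where I: "is_model I \<T> \<A>"
    using assms by (auto simp: consistent_def)
  \<comment> \<open>\<open>C\<close> and \<open>P\<close> collect the concept and role names
    occurring in the knowledge base; the reduct \<open>J\<close> keeps exactly their
    extensions.\<close>
  define C where "C = (\<Union>\<tau>\<in>\<T>. set1_tbox_axiom \<tau>) \<union> (\<Union>\<alpha>\<in>\<A>. set2_assertion \<alpha>)"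
  define P where "P = (\<Union>\<tau>\<in>\<T>. set2_tbox_axiom \<tau>) \<union> (\<Union>\<alpha>\<in>\<A>. set3_assertion \<alpha>)"
  have fC: "finite C" and fP: "finite P"
    using fin by (auto simp: C_def P_def finite_set1_tbox_axiom finite_set2_tbox_axiom
        finite_set2_assertion finite_set3_assertion)
  define J where "J = I\<lparr>cext := \<lambda>A. if A \<in> C then cext I A else {},
    rext := \<lambda>r. if r \<in> P then rext I r else {}\<rparr>"
  have B: "basic_ext J X = basic_ext I X" if "set_basic X \<subseteq> C" for X
    using that by (cases X) (auto simp: J_def)
  have R: "role_ext J r = role_ext I r" if "set_role r \<subseteq> P" for r
    using that by (cases r) (auto simp: J_def)
  have U: "universe J = universe I" by (simp add: J_def)
  have "sat_axiom J \<tau>" if \<tau>: "\<tau> \<in> \<T>" for \<tau>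
  proof -
    have s: "sat_axiom I \<tau>" using I \<tau> by (auto simp: is_model_def sat_tbox_def)
    have sub: "set1_tbox_axiom \<tau> \<subseteq> C" "set2_tbox_axiom \<tau> \<subseteq> P"
      using \<tau> by (auto simp: C_def P_def)
    show ?thesis
    proof (cases \<tau>)
      case (ConjSub As X)
      then have "\<And>A. A \<in> set As \<Longrightarrow> basic_ext J A = basic_ext I A" "basic_ext J X = basic_ext I X"
        using sub by (auto intro!: B)
      then show ?thesis using s ConjSub U by auto
    qed (use s sub B R in simp_all)
  qed
  moreover have "sat_assertion J \<alpha>" if \<alpha>: "\<alpha> \<in> \<A>" for \<alpha>
  proof -
    have "sat_assertion I \<alpha>" using I \<alpha> by (auto simp: is_model_def)
    moreover have "set2_assertion \<alpha> \<subseteq> C" "set3_assertion \<alpha> \<subseteq> P"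
      using \<alpha> by (auto simp: C_def P_def)
    ultimately show ?thesis by (cases \<alpha>) (auto simp: J_def)
  qed
  moreover have "is_interp J"
    using I by (auto simp: is_model_def sat_tbox_def is_interp_def J_def)
  ultimately have "is_model J \<T> \<A>"
    using I by (auto simp: is_model_def sat_tbox_def J_def)
  moreover have "finite {A. cext J A \<noteq> {}}"
    by (rule finite_subset[OF _ fC]) (auto simp: J_def split: if_splits)
  moreover have "finite {r. rext J r \<noteq> {}}"
    by (rule finite_subset[OF _ fP]) (auto simp: J_def split: if_splits)
  ultimately show thesis by (rule that)
qed


section \<open>The structure of the canonical model\<close>

text \<open>Countability of \<open>\<T>\<close> lets entailment over natural numbers transfer to any
  domain. The finiteness of the names with nonempty extension in \<open>I0\<close> bounds the
  entailed types, and a nonempty ABox gives the canonical domain an element.\<close>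

locale horn_kb =
  fixes \<T> :: "('c, 'r) tbox_axiom set" and \<A> :: "('i, 'c, 'r) assertion set"
    and I0 :: "('d, 'c, 'r, 'i) ind_interp"
  assumes T_countable: "countable \<T>" and A_nonempty: "\<A> \<noteq> {}"
    and I0: "is_model I0 \<T> \<A>"
    and finite_concepts: "finite {A. cext I0 A \<noteq> {}}"
    and finite_roles: "finite {r. rext I0 r \<noteq> {}}"
begin

abbreviation "cl \<equiv> closure_abox \<T> \<A>"

abbreviation "U \<equiv> can_universe \<T> \<A>"

abbreviation "CM \<equiv> can \<T> \<A>"

lemma I0_tbox: "sat_tbox I0 \<T>"
  using I0 by (simp add: is_model_def)

section \<open>Existence of good successor configurations\<close>

lemma finite_role_names: "finite {r. role_ext I0 r \<noteq> {}}"
proof (rule finite_subset)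
  show "{r. role_ext I0 r \<noteq> {}} \<subseteq> Role ` {r. rext I0 r \<noteq> {}} \<union> Inv ` {r. rext I0 r \<noteq> {}}"
  proof
    fix r assume "r \<in> {r. role_ext I0 r \<noteq> {}}"
    then show "r \<in> Role ` {r. rext I0 r \<noteq> {}} \<union> Inv ` {r. rext I0 r \<noteq> {}}" by (cases r) auto
  qed
qed (use finite_roles in simp)

text \<open>A satisfiable \<open>C\<close> entails only types realised in \<open>I0\<close>, so
  there are finitely many of them. The maximal ones among those not covered by \<open>F\<close> form
  a good configuration, and uniqueness identifies it with the definite description.\<close>

lemma good_succ_config_succ_config:
  assumes F: "F \<noteq> {}" "\<And>t. t \<in> F \<Longrightarrow> pi1 t = C" and C: "conj_ext I0 C \<noteq> {}"
  shows "good_succ_config \<T> F (succ_config \<T> F)"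
proof -
  obtain e where e: "e \<in> conj_ext I0 C" using C by blast
  \<comment> \<open>All premises \<open>M\<close> can be enlarged to the common first component
    \<open>C\<close>, so one set of candidates suffices.\<close>
  define E where "E = {u. entails_ex \<T> C (fst u) (snd u) \<and> \<not> (\<exists>t\<in>F. fst u \<subseteq> pi2 t \<and> snd u \<subseteq> pi3 t)}"
  have sub: "R \<subseteq> {r. role_ext I0 r \<noteq> {}} \<and> N \<subseteq> {A. cext I0 A \<noteq> {}}"
    if ex: "entails_ex \<T> C R N" for R N
  proof -
    obtain f where "f \<in> conj_ext I0 N" "\<And>r. r \<in> R \<Longrightarrow> (e, f) \<in> role_ext I0 r"
      using entails_ex_witness[OF T_countable ex I0_tbox e] by blast
    then show ?thesis unfolding conj_ext_def by blast
  qed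
  have finE: "finite E"
  proof (rule finite_subset)
    show "E \<subseteq> Pow {r. role_ext I0 r \<noteq> {}} \<times> Pow {A. cext I0 A \<noteq> {}}"
      unfolding E_def by (auto dest!: sub)
  qed (simp add: finite_role_names finite_concepts)
  \<comment> \<open>The order on pairs is componentwise inclusion, the one occurring in the
    definition of goodness.\<close>
  define S where "S = {u \<in> E. \<forall>v\<in>E. u \<le> v \<longrightarrow> u = v}"
  have max: "\<exists>v\<in>S. u \<le> v" if "u \<in> E" for u
    using finite_has_maximal2[OF finE that] unfolding S_def by blast
  have "good_succ_config \<T> F S"
    unfolding good_succ_config_def
  proof (intro conjI allI impI)
    fix M R N
    assume "\<exists>t\<in>F. M \<subseteq> pi1 t" "entails_ex \<T> M R N" "\<not> (\<exists>t\<in>F. R \<subseteq> pi2 t \<and> N \<subseteq> pi3 t)"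
    then have "(R, N) \<in> E" using F entails_ex_mono by (fastforce simp: E_def)
    then show "\<exists>u\<in>S. R \<subseteq> fst u \<and> N \<subseteq> snd u" using max by (fastforce simp: less_eq_prod_def)
  next
    show "\<forall>u\<in>S. \<exists>M. (\<exists>t\<in>F. M \<subseteq> pi1 t) \<and> entails_ex \<T> M (fst u) (snd u)"
      using F unfolding S_def E_def by blast
    show "\<not> (\<exists>u\<in>S. \<exists>u'\<in>S. u \<noteq> u' \<and> fst u \<subseteq> fst u' \<and> snd u \<subseteq> snd u')"
      unfolding S_def less_eq_prod_def by blast
    show "\<not> (\<exists>u\<in>S. \<exists>t\<in>F. fst u \<subseteq> pi2 t \<and> snd u \<subseteq> pi3 t)"
      unfolding S_def E_def by blast
  qed
  then show ?thesis
    unfolding succ_config_def by (metis good_succ_config_unique theI)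
qed

section \<open>Words, their labels and their environments\<close>

definition label :: "('i, 'c, 'r) word \<Rightarrow> 'c set" where
  "label w = (if snd w = [] then concepts_of cl (fst w) else pi3 (last (snd w)))"

text \<open>This is the set of 2-types whose successor configuration generates the children of
  \<open>w\<close>: the ABox neighbourhood of an individual, or the edge back to the parent. It
  allows individuals and longer words to be treated alike.\<close>

definition env :: "('i, 'c, 'r) word \<Rightarrow> ('c, 'r) type2 set" where
  "env w = (if snd w = [] then ind_types cl (fst w) else {type_inv (last (snd w))})"

abbreviation succs :: "('i, 'c, 'r) word \<Rightarrow> ('c, 'r) type1h set" where
  "succs w \<equiv> succ_config \<T> (env w)"

lemma label_simps [simp]:
  "label (a, []) = concepts_of cl a" "label (a, ks @ [k]) = pi3 k"
  by (simp_all add: label_def)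

lemma env_simps [simp]:
  "env (a, []) = ind_types cl a" "env (a, ks @ [k]) = {type_inv k}"
  by (simp_all add: env_def)

lemma universe_Nil [simp]: "(a, []) \<in> U \<longleftrightarrow> a \<in> inds \<A>"
  by (simp add: can_universe_def)

text \<open>Replaces the index-based chain condition by a one-letter recursion, which is the form
  needed for induction from the end of a word.\<close>

lemma universe_snoc:
  "(a, ks @ [k]) \<in> U \<longleftrightarrow>
     (a, ks) \<in> U \<and> pi1 k = label (a, ks) \<and> (pi2 k, pi3 k) \<in> succs (a, ks)"
proof (cases ks rule: rev_cases)
  case Nil
  then show ?thesis by (auto simp: can_universe_def)
next
  case (snoc ls l)
  define chain where
    "chain xs \<longleftrightarrow> (\<forall>i. Suc i < length xs \<longrightarrow> child \<T> (xs ! i) (xs ! Suc i))" for xs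
  have U_chain: "(a, xs) \<in> U \<longleftrightarrow> a \<in> inds \<A> \<and> (xs \<noteq> [] \<longrightarrow> pi1 (hd xs) = concepts_of cl a \<and>
      (pi2 (hd xs), pi3 (hd xs)) \<in> succ_config \<T> (ind_types cl a)) \<and> chain xs" for xs
    by (simp add: can_universe_def chain_def)
  have chain_snoc: "chain (ks @ [k]) \<longleftrightarrow> chain ks \<and> child \<T> l k" (is "?L \<longleftrightarrow> ?R")
  proof
    assume L: ?L
    show ?R
      unfolding chain_def
    proof (intro conjI allI impI)
      fix i assume "Suc i < length ks"
      then show "child \<T> (ks ! i) (ks ! Suc i)" using L[unfolded chain_def, rule_format, of i] by (simp add: nth_append)
    next
      show "child \<T> l k" using L[unfolded chain_def, rule_format, of "length ls"] snoc by (simp add: nth_append)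
    qed
  next
    assume R: ?R
    show ?L
      unfolding chain_def
    proof (intro allI impI)
      fix i assume i: "Suc i < length (ks @ [k])"
      show "child \<T> ((ks @ [k]) ! i) ((ks @ [k]) ! Suc i)"
      proof (cases "Suc i < length ks")
        case True then show ?thesis using R by (simp add: chain_def nth_append)
      next
        case False
        then have "i = length ls" using i snoc by simp
        then show ?thesis using R snoc by (simp add: nth_append)
      qed
    qed
  qed
  have "ks \<noteq> []" "hd (ks @ [k]) = hd ks" "label (a, ks) = pi3 l" "env (a, ks) = {type_inv l}"
    using snoc by (simp_all add: hd_append)
  then show ?thesis unfolding U_chain chain_snoc child_def by simp
qed

section \<open>Completeness and maximality of the successors of a word\<close>

lemma pi1_env: "t \<in> env w \<Longrightarrow> pi1 t = label w"
  by (auto simp: env_def label_def ind_types_def type_inv_def)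

lemma env_nonempty: "env w \<noteq> {}"
  by (auto simp: env_def ind_types_def)

lemma good_succsI:
  assumes "conj_ext I0 (label w) \<noteq> {}"
  shows "good_succ_config \<T> (env w) (succs w)"
  using good_succ_config_succ_config[OF env_nonempty pi1_env assms] .

lemma good_succ_configD:
  assumes "good_succ_config \<T> F S"
  shows "t \<in> F \<Longrightarrow> M \<subseteq> pi1 t \<Longrightarrow> entails_ex \<T> M R N \<Longrightarrow>
      (\<exists>t\<in>F. R \<subseteq> pi2 t \<and> N \<subseteq> pi3 t) \<or> (\<exists>u\<in>S. R \<subseteq> fst u \<and> N \<subseteq> snd u)"
    and "u \<in> S \<Longrightarrow> \<exists>M. \<exists>t\<in>F. M \<subseteq> pi1 t \<and> entails_ex \<T> M (fst u) (snd u)"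
    and "u \<in> S \<Longrightarrow> v \<in> S \<Longrightarrow> fst u \<subseteq> fst v \<Longrightarrow> snd u \<subseteq> snd v \<Longrightarrow> u = v"
    and "u \<in> S \<Longrightarrow> t \<in> F \<Longrightarrow> fst u \<subseteq> pi2 t \<Longrightarrow> \<not> snd u \<subseteq> pi3 t"
  using assms unfolding good_succ_config_def by meson+

lemma good_succ_entails:
  assumes "good_succ_config \<T> (env w) (succs w)" "u \<in> succs w"
  shows "entails_ex \<T> (label w) (fst u) (snd u)"
proof -
  obtain M t where "t \<in> env w" "M \<subseteq> pi1 t" "entails_ex \<T> M (fst u) (snd u)"
    using good_succ_configD(2)[OF assms] by blast
  then show ?thesis using pi1_env entails_ex_mono by metis
qed

text \<open>Following entailed witnesses in \<open>I0\<close> along the word. Satisfiability of the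
  parent label makes its configuration good, so the next letter is entailed and has a witness in
  \<open>I0\<close>. This licenses reasoning about \<open>succ_config\<close> at every word.\<close>

lemma label_satisfiable: "(a, ks) \<in> U \<Longrightarrow> conj_ext I0 (label (a, ks)) \<noteq> {}"
proof (induction ks rule: rev_induct)
  case Nil
  then have "den I0 a \<in> conj_ext I0 (concepts_of cl a)"
    using I0 closure_abox_sound[OF T_countable I0]
    by (fastforce simp: conj_ext_def is_model_def concepts_of_def)
  then show ?case by auto
next
  case (snoc k ks)
  then have "conj_ext I0 (label (a, ks)) \<noteq> {}" and k: "(pi2 k, pi3 k) \<in> succs (a, ks)"
    by (simp_all add: universe_snoc)
  moreover from this obtain e where e: "e \<in> conj_ext I0 (label (a, ks))" by blast
  ultimately have ex: "entails_ex \<T> (label (a, ks)) (pi2 k) (pi3 k)"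
    using good_succ_entails[OF good_succsI] by fastforce
  show ?case using entails_ex_witness[OF T_countable ex I0_tbox e] by auto
qed

lemma good_succs: "w \<in> U \<Longrightarrow> good_succ_config \<T> (env w) (succs w)"
  using label_satisfiable good_succsI by (cases w) blast

lemma succs_complete:
  assumes "w \<in> U" "entails_ex \<T> (label w) R N"
  shows "(\<exists>t\<in>env w. R \<subseteq> pi2 t \<and> N \<subseteq> pi3 t) \<or> (\<exists>u\<in>succs w. R \<subseteq> fst u \<and> N \<subseteq> snd u)"
proof -
  obtain t where t: "t \<in> env w" using env_nonempty by blast
  then show ?thesis
    using good_succ_configD(1)[OF good_succs[OF assms(1)] t _ assms(2)] pi1_env[OF t] by simp
qed

lemma succs_entails: "w \<in> U \<Longrightarrow> u \<in> succs w \<Longrightarrow> entails_ex \<T> (label w) (fst u) (snd u)"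
  using good_succ_entails good_succs by blast

lemma succs_antichain:
  "w \<in> U \<Longrightarrow> u \<in> succs w \<Longrightarrow> v \<in> succs w \<Longrightarrow> fst u \<subseteq> fst v \<Longrightarrow> snd u \<subseteq> snd v \<Longrightarrow> u = v"
  using good_succ_configD(3)[OF good_succs] .

lemma succs_uncovered:
  "w \<in> U \<Longrightarrow> u \<in> succs w \<Longrightarrow> t \<in> env w \<Longrightarrow> fst u \<subseteq> pi2 t \<Longrightarrow> snd u \<subseteq> pi3 t \<Longrightarrow> False"
  using good_succ_configD(4)[OF good_succs] by blast

text \<open>A larger entailed type cannot be covered by the environment, since \<open>(R, N)\<close>
  would then be covered too. Hence it lies below some successor \<open>v\<close>, and the antichain
  property forces \<open>v = (R, N)\<close>.\<close>

lemma succs_maximal: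
  assumes w: "w \<in> U" "(R, N) \<in> succs w" and ex: "entails_ex \<T> (label w) R' N'"
    and sub: "R \<subseteq> R'" "N \<subseteq> N'"
  shows "R' = R \<and> N' = N"
proof -
  obtain v where v: "v \<in> succs w" "R' \<subseteq> fst v" "N' \<subseteq> snd v"
    using succs_complete[OF w(1) ex] succs_uncovered[OF w] sub by fastforce
  then have "(R, N) = v" using succs_antichain[OF w v(1)] sub by auto
  then show ?thesis using v sub by auto
qed

text \<open>For individuals this is a closure rule of the ABox. For longer words, adding
  \<open>B\<close> to the last type keeps it entailed by the parent label, so maximality shows that
  \<open>B\<close> was already there.\<close>

lemma label_closed:
  assumes "w \<in> U" "entails_concept \<T> (label w) B"
  shows "B \<in> label w"
proof (cases w)
  case (Pair a ks)
  show ?thesis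
  proof (cases ks rule: rev_cases)
    case Nil
    then show ?thesis using assms Pair closure_abox.conj_incl[of a \<A> "concepts_of cl a" \<T> B]
      by (auto simp: concepts_of_def)
  next
    case (snoc ls l)
    then have l: "(a, ls) \<in> U" "(pi2 l, pi3 l) \<in> succs (a, ls)"
      using assms Pair by (auto simp: universe_snoc)
    have "entails_ex \<T> (label (a, ls)) (pi2 l) (insert B (pi3 l))"
      using entails_ex_concept succs_entails[OF l] assms(2) Pair snoc by simp
    then show ?thesis using succs_maximal[OF l] Pair snoc by auto
  qed
qed

section \<open>Concept and role extensions of the canonical model\<close>

lemma universe_CM [simp]: "universe CM = U"
  by (simp add: can_def)

lemma den_CM [simp]: "den CM a = (a, [])"
  by (simp add: can_def)

lemma closure_inds: "\<alpha> \<in> cl \<Longrightarrow> assertion_inds \<alpha> \<subseteq> inds \<A>"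
  using closure_abox_sound[OF T_countable I0] by blast

lemma cext_CM: "cext CM B = {w \<in> U. B \<in> label w}"
proof -
  have "a \<in> inds \<A>" if "CA B a \<in> cl" for a
    using closure_inds[OF that] by simp
  then show ?thesis by (auto simp: can_def label_def concepts_of_def)
qed

lemma basic_ext_CM: "w \<in> U \<Longrightarrow> w \<in> basic_ext CM X \<longleftrightarrow> X \<in> basics (label w)"
  by (cases X) (auto simp: cext_CM)

lemma role_ext_CM:
  "(w, w') \<in> role_ext CM r \<longleftrightarrow>
    (\<exists>a b. w = (a, []) \<and> w' = (b, []) \<and> role_assertion r a b \<in> cl) \<or>
    (\<exists>a ks k. w = (a, ks) \<and> w' = (a, ks @ [k]) \<and> w' \<in> U \<and> r \<in> pi2 k) \<or>
    (\<exists>a ks k. w = (a, ks @ [k]) \<and> w' = (a, ks) \<and> w \<in> U \<and> rinv r \<in> pi2 k)"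
  by (cases r) (auto simp: can_def)

lemma role_ext_CM_Nil_Nil [simp]:
  "((a, []), (b, [])) \<in> role_ext CM r \<longleftrightarrow> role_assertion r a b \<in> cl"
  by (auto simp: role_ext_CM)

lemma role_ext_CM_down [simp]:
  "((a, ks), (a, ks @ [k])) \<in> role_ext CM r \<longleftrightarrow> (a, ks @ [k]) \<in> U \<and> r \<in> pi2 k"
  by (auto simp: role_ext_CM)

lemma role_ext_CM_up [simp]:
  "((a, ks @ [k]), (a, ks)) \<in> role_ext CM r \<longleftrightarrow> (a, ks @ [k]) \<in> U \<and> rinv r \<in> pi2 k"
  by (auto simp: role_ext_CM)

text \<open>Besides the shape of the edge, the tree cases deliver the entailed restriction that
  created it; most later case analyses start from this restriction.\<close>

lemma role_ext_CM_cases [consumes 1, case_names ind child parent]: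
  assumes "(w, w') \<in> role_ext CM r"
  obtains a b where "w = (a, [])" "w' = (b, [])" "a \<in> inds \<A>" "b \<in> inds \<A>" "role_assertion r a b \<in> cl"
  | a ks k where "w = (a, ks)" "w' = (a, ks @ [k])" "(a, ks @ [k]) \<in> U" "(a, ks) \<in> U" "r \<in> pi2 k"
      "pi1 k = label w" "(pi2 k, pi3 k) \<in> succs w"
      "entails_ex \<T> (label w) (pi2 k) (pi3 k)"
  | a ks k where "w = (a, ks @ [k])" "w' = (a, ks)" "(a, ks @ [k]) \<in> U" "(a, ks) \<in> U" "rinv r \<in> pi2 k"
      "pi1 k = label w'" "(pi2 k, pi3 k) \<in> succs w'"
      "entails_ex \<T> (label w') (pi2 k) (pi3 k)"
proof -
  from assms consider (1) a b where "w = (a, [])" "w' = (b, [])" "role_assertion r a b \<in> cl"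
    | (2) a ks k where "w = (a, ks)" "w' = (a, ks @ [k])" "w' \<in> U" "r \<in> pi2 k"
    | (3) a ks k where "w = (a, ks @ [k])" "w' = (a, ks)" "w \<in> U" "rinv r \<in> pi2 k"
    unfolding role_ext_CM by blast
  then show thesis
  proof cases
    case 1
    then show ?thesis using closure_inds[OF 1(3)] that(1) by auto
  next
    case 2
    then show ?thesis using that(2)[of a ks k] succs_entails[of "(a, ks)" "(pi2 k, pi3 k)"]
      by (auto simp: universe_snoc)
  next
    case 3
    then show ?thesis using that(3)[of a ks k] succs_entails[of "(a, ks)" "(pi2 k, pi3 k)"]
      by (auto simp: universe_snoc)
  qed
qed

lemma interp_CM: "is_interp CM"
proof -
  obtain \<alpha> where "\<alpha> \<in> \<A>" using A_nonempty by blast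
  moreover have "assertion_inds \<alpha> \<noteq> {}" by (cases \<alpha>) auto
  ultimately have "inds \<A> \<noteq> {}" by (auto simp: inds_def)
  then have "U \<noteq> {}" using universe_Nil by blast
  moreover have "w \<in> U \<and> w' \<in> U" if "(w, w') \<in> rext CM r" for w w' r
  proof -
    have "(w, w') \<in> role_ext CM (Role r)" using that by simp
    then show ?thesis by (cases rule: role_ext_CM_cases) simp_all
  qed
  then have "rext CM r \<subseteq> U \<times> U" for r by auto
  ultimately show ?thesis by (simp add: is_interp_def cext_CM)
qed

text \<open>A 2-type in the environment is realised by a named individual or by the parent. Nonempty
  roles exclude the dummy triple that \<open>ind_types\<close> inserts, which describes no
  neighbour.\<close>

lemma env_neighbour:
  assumes "w \<in> U" "t \<in> env w" "pi2 t \<noteq> {}"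
  obtains w' where "w' \<in> U" "label w' = pi3 t" "\<And>r. r \<in> pi2 t \<Longrightarrow> (w, w') \<in> role_ext CM r"
proof (cases w)
  case (Pair a ks)
  show thesis
  proof (cases ks rule: rev_cases)
    case Nil
    then obtain b r where t: "t = (concepts_of cl a, roles_between cl a b, concepts_of cl b)"
      "r \<in> roles_between cl a b"
      using assms Pair by (auto simp: ind_types_def)
    then have "b \<in> inds \<A>" using closure_inds by (fastforce simp: roles_between_def)
    then show thesis using t Pair Nil by (intro that[of "(b, [])"]) (auto simp: roles_between_def)
  next
    case (snoc ls l)
    then show thesis using assms Pair
      by (intro that[of "(a, ls)"]) (auto simp: type_inv_def universe_snoc)
  qed
qed

text \<open>A neighbour that is not a child is a named individual or the parent, and the environment
  records exactly these. Uncoveredness of successors thereby becomes a statement about actual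
  neighbours.\<close>

lemma neighbour_env:
  assumes "w \<in> U" "(w, w') \<in> role_ext CM r" "\<nexists>k. w' = (fst w, snd w @ [k])"
  shows "\<exists>t\<in>env w. pi3 t = label w' \<and> (\<forall>s. (w, w') \<in> role_ext CM s \<longrightarrow> s \<in> pi2 t)"
  using assms(2)
proof (cases rule: role_ext_CM_cases)
  case (ind a b)
  then show ?thesis
    by (intro bexI[of _ "(concepts_of cl a, roles_between cl a b, concepts_of cl b)"])
      (auto simp: ind_types_def roles_between_def)
next
  case (child a ks k)
  then show ?thesis using assms(3) by (metis fst_conv snd_conv)
next
  case (parent a ks k)
  then show ?thesis
    by (intro bexI[of _ "type_inv k"]) (auto simp: type_inv_def)
qed


section \<open>Universality and rigidity\<close>

lemma homomorphism_into_model: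
  fixes J :: "('e, 'c, 'r, 'i) ind_interp"
  assumes J: "is_model J \<T> \<A>"
  shows "\<exists>h. homomorphism (inds \<A>) h CM J"
proof -
  \<comment> \<open>A choice of witness in \<open>J\<close> for the letter \<open>k\<close> at
    \<open>e\<close>. It is arbitrary where no witness exists, which does not occur along words of
    the canonical domain.\<close>
  define next_el :: "'e \<Rightarrow> ('c, 'r) type2 \<Rightarrow> 'e" where
    "next_el e k = (SOME f. f \<in> conj_ext J (pi3 k) \<and> (\<forall>r\<in>pi2 k. (e, f) \<in> role_ext J r))" for e k
  define h :: "('i, 'c, 'r) word \<Rightarrow> 'e" where "h w = foldl next_el (den J (fst w)) (snd w)" for w
  have h_Nil: "h (a, []) = den J a" and h_snoc: "h (a, ks @ [k]) = next_el (h (a, ks)) k" for a ks k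
    by (simp_all add: h_def)
  have st: "sat_tbox J \<T>" using J by (simp add: is_model_def)
  have step: "h (a, ks @ [k]) \<in> conj_ext J (pi3 k) \<and>
      (\<forall>r\<in>pi2 k. (h (a, ks), h (a, ks @ [k])) \<in> role_ext J r)"
    if k: "(a, ks @ [k]) \<in> U" and IH: "h (a, ks) \<in> conj_ext J (label (a, ks))" for a ks k
  proof -
    have ex: "entails_ex \<T> (label (a, ks)) (pi2 k) (pi3 k)"
      using k succs_entails[of "(a, ks)" "(pi2 k, pi3 k)"] by (simp add: universe_snoc)
    have "\<exists>f. f \<in> conj_ext J (pi3 k) \<and> (\<forall>r\<in>pi2 k. (h (a, ks), f) \<in> role_ext J r)"
      using entails_ex_witness[OF T_countable ex st IH] unfolding Bex_def .
    then show ?thesis unfolding h_snoc next_el_def by (rule someI_ex)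
  qed
  have lab: "h (a, ks) \<in> conj_ext J (label (a, ks))" if "(a, ks) \<in> U" for a ks
    using that
  proof (induction ks rule: rev_induct)
    case Nil
    have "den J a \<in> cext J A" if "CA A a \<in> cl" for A
      using closure_abox_sound[OF T_countable J that] by simp
    moreover have "den J a \<in> universe J" using Nil J by (auto simp: is_model_def)
    ultimately show ?case by (simp add: h_Nil conj_ext_def concepts_of_def)
  next
    case (snoc k ks)
    then show ?case using step by (auto simp: universe_snoc)
  qed
  have roles: "(h w, h w') \<in> role_ext J r" if "(w, w') \<in> role_ext CM r" for w w' r
    using that
  proof (cases rule: role_ext_CM_cases)
    case (ind a b)
    then show ?thesis using closure_abox_sound[OF T_countable J ind(5)] by (simp add: h_Nil)
  next
    case (child a ks k)
    then show ?thesis using step lab by auto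
  next
    case (parent a ks k)
    then show ?thesis using step[of a ks k] lab[of a ks] by (auto dest!: bspec[of _ _ "rinv r"])
  qed
  have "h w \<in> conj_ext J (label w)" if "w \<in> U" for w
    using lab that by (cases w) blast
  moreover have "(h w, h w') \<in> rext J r" if "(w, w') \<in> rext CM r" for w w' r
    using roles[of w w' "Role r"] that by simp
  ultimately have "homomorphism (inds \<A>) h CM J"
    by (auto simp: homomorphism_def h_Nil cext_CM conj_ext_def)
  then show ?thesis by blast
qed

section \<open>Rigidity of the canonical model\<close>

lemma endomorphism_id:
  assumes h: "homomorphism (inds \<A>) h CM CM"
  shows "(a, ks) \<in> U \<Longrightarrow> h (a, ks) = (a, ks)"
proof (induction ks rule: rev_induct)
  case Nil
  then show ?case using h by (auto simp: homomorphism_def)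
next
  case (snoc k ks)
  let ?w = "(a, ks)" and ?v = "h (a, ks @ [k])"
  have w: "?w \<in> U" "(pi2 k, pi3 k) \<in> succs ?w" "pi1 k = label ?w"
    using snoc.prems by (simp_all add: universe_snoc)
  have hw: "h ?w = ?w" using snoc.IH w by blast
  have R: "(?w, ?v) \<in> role_ext CM r" if "r \<in> pi2 k" for r
    using homomorphism_role[OF h interp_CM, of ?w "(a, ks @ [k])" r] snoc.prems that hw by simp
  have N: "pi3 k \<subseteq> label ?v"
  proof
    fix B assume "B \<in> pi3 k"
    then have "(a, ks @ [k]) \<in> cext CM B" using snoc.prems by (simp add: cext_CM)
    then have "?v \<in> cext CM B" using h snoc.prems by (simp add: homomorphism_def)
    then show "B \<in> label ?v" by (simp add: cext_CM)
  qed
  \<comment> \<open>Role conjunctions are nonempty, so at least one role connects the fixed word to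
    the image of its child.\<close>
  obtain r where r: "r \<in> pi2 k"
    using entails_ex_nonempty succs_entails[OF w(1,2)] by fastforce
  show ?case
  proof (cases "\<exists>k'. ?v = (a, ks @ [k'])")
    case True
    then obtain k' where k': "?v = (a, ks @ [k'])" by blast
    then have U': "(a, ks @ [k']) \<in> U" using R[OF r] by simp
    \<comment> \<open>The image is again a child, with a type containing that of \<open>k\<close>;
      comparable successors coincide.\<close>
    have "(pi2 k, pi3 k) = (pi2 k', pi3 k')"
      using succs_antichain[OF w(1,2), of "(pi2 k', pi3 k')"] U' R N k'
      by (auto simp: universe_snoc)
    moreover have "pi1 k = pi1 k'" using U' w by (simp add: universe_snoc)
    ultimately show ?thesis using k' by (simp add: prod_eq_iff)
  next
    case False
    then have "\<nexists>k. ?v = (fst ?w, snd ?w @ [k])" by simp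
    then obtain t where "t \<in> env ?w" "pi3 t = label ?v" "\<And>s. (?w, ?v) \<in> role_ext CM s \<Longrightarrow> s \<in> pi2 t"
      using neighbour_env[OF w(1) R[OF r]] by blast
    \<comment> \<open>Otherwise \<open>t\<close> would cover the type of \<open>k\<close>, although
      successors are uncovered.\<close>
    then show ?thesis using succs_uncovered[OF w(1,2), of t] R N by auto
  qed
qed

lemma endomorphism_eq: "homomorphism (inds \<A>) h CM CM \<Longrightarrow> w \<in> U \<Longrightarrow> h w = w"
  using endomorphism_id by (cases w) blast

lemma core_CM: "core (inds \<A>) CM"
  by (simp add: core_def strong_homomorphism_def inj_on_def endomorphism_eq)


section \<open>The canonical model is a model\<close>

text \<open>Along this map, \<open>Bot\<close> axioms and the distinctness of named individuals are
  pulled back from \<open>I0\<close>.\<close>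

lemma homomorphism_into_I0: obtains h where "homomorphism (inds \<A>) h CM I0"
  using homomorphism_into_model[OF I0] by blast

lemma concepts_of_forall:
  assumes "ForallSub X r (Name B) \<in> \<T>" "X \<in> basics (concepts_of cl a)" "role_assertion r a b \<in> cl"
  shows "B \<in> concepts_of cl b"
  using closure_abox.forall_ax[OF assms(1)] assms(2,3) by (simp add: concepts_of_def has_iff)

text \<open>Each kind of edge has its own reason: an ABox closure rule between individuals,
  maximality of the type of a child, and closedness of the label of a parent.\<close>

lemma sat_CM_ForallSub:
  assumes ax: "ForallSub X r Y \<in> \<T>"
  shows "sat_axiom CM (ForallSub X r Y)"
proof -
  have "w' \<in> basic_ext CM Y" if w: "w \<in> basic_ext CM X" and ww': "(w, w') \<in> role_ext CM r" for w w'
  proof -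
    have u: "w \<in> U" "w' \<in> U" using role_ext_universe[OF interp_CM, of r] ww' by auto
    have X: "X \<in> basics (label w)" using w u by (simp add: basic_ext_CM)
    show ?thesis
    proof (cases Y)
      case Top
      then show ?thesis using u by simp
    next
      case Bot
      \<comment> \<open>The image of \<open>w'\<close> in \<open>I0\<close> would lie in the empty
        extension of \<open>Bot\<close>.\<close>
      obtain h where h: "homomorphism (inds \<A>) h CM I0" using homomorphism_into_I0 .
      have "h w' \<in> basic_ext I0 Y"
        using sat_tboxD[OF I0_tbox ax] homomorphism_basic[OF h interp_CM w]
          homomorphism_role[OF h interp_CM ww'] by auto
      then show ?thesis using Bot by simp
    next
      case (Name B)
      note ax' = ax[unfolded Name]
      have "B \<in> label w'" using ww'
      proof (cases rule: role_ext_CM_cases)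
        case (ind a b)
        then show ?thesis using concepts_of_forall[OF ax'] X by simp
      next
        case (child a ks k)
        have "entails_ex \<T> (label w) (pi2 k) (insert B (pi3 k))"
          using entails_ex_forall[OF child(8) ax' X child(5)] .
        then show ?thesis using succs_maximal[OF u(1) child(7)] child by auto
      next
        case (parent a ks k)
        have "entails_concept \<T> (label w') B"
          using entails_concept_forall_back[OF parent(8) ax' _ parent(5)] X parent by simp
        then show ?thesis using label_closed u by blast
      qed
      then show ?thesis using Name u by (simp add: cext_CM)
    qed
  qed
  then show ?thesis by auto
qed

text \<open>Edges towards the parent are stored as inverse roles in the letter, so role inclusions
  are needed in inverted form there.\<close>

lemma entails_role_rinv: "RoleSub r s \<in> \<T> \<Longrightarrow> entails_role \<T> (rinv r) (rinv s)"
  by (force simp: entails_role_def sat_tbox_def)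

lemma entails_role_axiom: "RoleSub r s \<in> \<T> \<Longrightarrow> entails_role \<T> r s"
  by (force simp: entails_role_def sat_tbox_def)

lemma sat_CM_RoleSub:
  assumes ax: "RoleSub r s \<in> \<T>"
  shows "sat_axiom CM (RoleSub r s)"
proof -
  have "(w, w') \<in> role_ext CM s" if "(w, w') \<in> role_ext CM r" for w w'
    using that
  proof (cases rule: role_ext_CM_cases)
    case (ind a b)
    then show ?thesis using closure_abox.role_incl[OF entails_role_axiom[OF ax]] by simp
  next
    case (child a ks k)
    have "entails_ex \<T> (label w) (insert s (pi2 k)) (pi3 k)"
      using entails_ex_role[OF child(8) entails_role_axiom[OF ax] child(5)] .
    then have "s \<in> pi2 k" using succs_maximal[OF _ child(7)] child by auto
    then show ?thesis using child by simp
  next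
    case (parent a ks k)
    have "entails_ex \<T> (label w') (insert (rinv s) (pi2 k)) (pi3 k)"
      using entails_ex_role[OF parent(8) entails_role_rinv[OF ax] parent(5)] .
    then have "rinv s \<in> pi2 k" using succs_maximal[OF _ parent(7)] parent by auto
    then show ?thesis using parent by simp
  qed
  then show ?thesis by auto
qed

text \<open>The entailed type \<open>({r}, N)\<close> is either covered by the environment, which
  yields an existing neighbour, or contained in a successor, which yields a child.\<close>

lemma sat_CM_ExistsSub:
  assumes ax: "ExistsSub X r Y \<in> \<T>"
  shows "sat_axiom CM (ExistsSub X r Y)"
proof -
  have "\<exists>w'\<in>basic_ext CM Y. (w, w') \<in> role_ext CM r" if w: "w \<in> basic_ext CM X" for w
  proof -
    have u: "w \<in> U" using basic_ext_universe[OF interp_CM] w by auto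
    then have X: "X \<in> basics (label w)" using w by (simp add: basic_ext_CM)
    have "Y \<noteq> Bot"
    proof
      assume "Y = Bot"
      moreover obtain h where h: "homomorphism (inds \<A>) h CM I0" using homomorphism_into_I0 .
      ultimately show False
        using sat_tboxD[OF I0_tbox ax] homomorphism_basic[OF h interp_CM w] by auto
    qed
    define N where "N = (case Y of Name B \<Rightarrow> {B} | _ \<Rightarrow> {})"
    have NY: "w' \<in> basic_ext CM Y" if "w' \<in> U" "N \<subseteq> label w'" for w'
      using that \<open>Y \<noteq> Bot\<close> by (cases Y) (auto simp: N_def cext_CM)
    have "entails_ex \<T> (label w) {r} N"
      using entails_ex_axiom[OF ax X] by (simp add: N_def)
    note succs_complete[OF u this]
    then consider t where "t \<in> env w" "r \<in> pi2 t" "N \<subseteq> pi3 t"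
      | u where "u \<in> succs w" "r \<in> fst u" "N \<subseteq> snd u"
      by blast
    then show ?thesis
    proof cases
      case (1 t)
      then show ?thesis using env_neighbour[OF u 1(1)] NY by (metis empty_iff)
    next
      case (2 v)
      obtain a ks where w': "w = (a, ks)" by (cases w)
      \<comment> \<open>The letter of the child is the successor type \<open>v\<close> completed by
        the label of \<open>w\<close> as first component.\<close>
      have "(a, ks @ [(label w, v)]) \<in> U" using 2 u w' by (simp add: universe_snoc)
      then show ?thesis using 2 NY[of "(a, ks @ [(label w, v)])"] w'
        by (intro bexI[of _ "(a, ks @ [(label w, v)])"]) auto
    qed
  qed
  then show ?thesis by auto
qed

lemma sat_CM_ConjSub:
  assumes ax: "ConjSub As Y \<in> \<T>"
  shows "sat_axiom CM (ConjSub As Y)"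
proof -
  have "w \<in> basic_ext CM Y" if u: "w \<in> U" and w: "\<And>X. X \<in> set As \<Longrightarrow> w \<in> basic_ext CM X" for w
  proof (cases Y)
    case Top
    then show ?thesis using u by simp
  next
    case Bot
    obtain h where h: "homomorphism (inds \<A>) h CM I0" using homomorphism_into_I0 .
    have "h w \<in> universe I0" using h u by (auto simp: homomorphism_def)
    then have "h w \<in> basic_ext I0 Y"
      using sat_tboxD[OF I0_tbox ax] homomorphism_basic[OF h interp_CM w] by auto
    then show ?thesis using Bot by simp
  next
    case (Name B)
    have "entails_concept \<T> (label w) B"
      unfolding entails_concept_def
    proof (intro allI impI subsetI)
      fix I :: "(nat, 'c, 'r) interp" and e
      assume I: "sat_tbox I \<T>" and e: "e \<in> conj_ext I (label w)"
      then have "e \<in> basic_ext I X" if "X \<in> set As" for X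
        using conj_ext_basic[OF e] w[OF that] u by (simp add: basic_ext_CM)
      moreover have "e \<in> universe I" using e by (simp add: conj_ext_def)
      ultimately show "e \<in> cext I B" using sat_tboxD[OF I ax] Name by auto
    qed
    then show ?thesis using Name u label_closed by (simp add: cext_CM)
  qed
  then show ?thesis by auto
qed

text \<open>The functionality axiom pushes the whole type \<open>v\<close> into the recorded
  neighbour \<open>t\<close>, so \<open>v\<close> would be covered and could not be a
  successor.\<close>

lemma at_most_one_child_env:
  assumes ax: "AtMostOne X r Y \<in> \<T>" and u: "w \<in> U" and X: "X \<in> basics (label w)"
    and t: "t \<in> env w" "r \<in> pi2 t" "Y \<in> basics (pi3 t)"
    and v: "v \<in> succs w" "r \<in> fst v" "Y \<in> basics (snd v)"
  shows False
proof (cases w)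
  case (Pair a ks)
  have ex: "entails_ex \<T> (label w) (fst v) (snd v)" using succs_entails[OF u v(1)] .
  have "fst v \<subseteq> pi2 t \<and> snd v \<subseteq> pi3 t"
  proof (cases ks rule: rev_cases)
    case Nil
    then obtain b where b: "t = (concepts_of cl a, roles_between cl a b, concepts_of cl b)"
      using t Pair by (auto simp: ind_types_def)
    have h: "has cl X a" "role_assertion r a b \<in> cl" "has cl Y b"
      "\<forall>A\<in>concepts_of cl a. CA A a \<in> cl"
      using b t X Pair Nil by (auto simp: has_iff roles_between_def concepts_of_def)
    have "entails_ex \<T> (concepts_of cl a) (fst v) (snd v)" using ex Pair Nil by simp
    \<comment> \<open>For individuals the two merging rules of the closure absorb \<open>v\<close>
      into the facts about \<open>b\<close>.\<close>
    then show ?thesis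
      using closure_abox.merge_concept[OF ax h] closure_abox.merge_role[OF ax h] v b
      by (auto simp: roles_between_def concepts_of_def)
  next
    case (snoc ls l)
    then have l: "(a, ls) \<in> U" "pi1 l = label (a, ls)" "(pi2 l, pi3 l) \<in> succs (a, ls)"
      and tl: "t = type_inv l"
      using u t Pair by (auto simp: universe_snoc)
    have exl: "entails_ex \<T> (label (a, ls)) (pi2 l) (pi3 l)"
      using succs_entails[OF l(1,3)] by simp
    have A: "X \<in> basics (pi3 l)" "rinv r \<in> pi2 l" "Y \<in> basics (label (a, ls))"
      "entails_ex \<T> (pi3 l) (fst v) (snd v)"
      using X t tl l ex Pair snoc by (auto simp: type_inv_def)
    \<comment> \<open>The witness for \<open>v\<close> is identified with the parent: its concepts
      follow from the parent label, and its inverted roles enlarge the edge \<open>l\<close>, which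
      is already maximal.\<close>
    note merged = entails_merge_back[OF exl A(4) ax A(1,2) v(2) A(3) v(3)]
    have "snd v \<subseteq> label (a, ls)" using merged(1) label_closed[OF l(1)] by blast
    moreover have "rinv ` fst v \<subseteq> pi2 l" using succs_maximal[OF l(1,3) merged(2)] by auto
    then have "fst v \<subseteq> rinv ` pi2 l" by auto
    ultimately show ?thesis using tl l by (simp add: type_inv_def)
  qed
  then show False using succs_uncovered[OF u v(1) t(1)] by blast
qed

text \<open>Two children would be merged into one larger type, a child and a non-child cannot
  coexist, and two non-children are either named individuals or both the parent.\<close>

lemma sat_CM_AtMostOne:
  assumes ax: "AtMostOne X r Y \<in> \<T>"
  shows "sat_axiom CM (AtMostOne X r Y)"
proof -
  have "w1 = w2"
    if w: "w \<in> basic_ext CM X" and w1: "w1 \<in> basic_ext CM Y" "(w, w1) \<in> role_ext CM r"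
      and w2: "w2 \<in> basic_ext CM Y" "(w, w2) \<in> role_ext CM r" for w w1 w2
  proof -
    have u: "w \<in> U" "w1 \<in> U" "w2 \<in> U"
      using basic_ext_universe[OF interp_CM] w w1 w2 by auto
    have X: "X \<in> basics (label w)" and Y: "Y \<in> basics (label w1)" "Y \<in> basics (label w2)"
      using w w1 w2 u by (simp_all add: basic_ext_CM)
    let ?child = "\<lambda>v. \<exists>k. v = (fst w, snd w @ [k])"
    have mixed: False if m: "?child v" "\<not> ?child v'" "(w, v) \<in> role_ext CM r" "(w, v') \<in> role_ext CM r"
      "Y \<in> basics (label v)" "Y \<in> basics (label v')" for v v'
    proof -
      obtain t where t: "t \<in> env w" "pi3 t = label v'" "r \<in> pi2 t"
        using neighbour_env[OF u(1) m(4,2)] m(4) by blast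
      obtain a ks where aks: "w = (a, ks)" by (cases w)
      obtain k where k: "v = (a, ks @ [k])" using m(1) aks by auto
      have v: "(pi2 k, pi3 k) \<in> succs w" "r \<in> pi2 k" using m(3) k aks by (auto simp: universe_snoc)
      have Yt: "Y \<in> basics (pi3 t)" and Yk: "Y \<in> basics (pi3 k)" using m(5,6) t k by simp_all
      show False
        by (rule at_most_one_child_env[OF ax u(1) X t(1,3) Yt v(1)]) (use v Yk in simp_all)
    qed
    consider "?child w1" "?child w2" | "\<not> ?child w1" "\<not> ?child w2"
      using mixed w1 w2 Y by blast
    then show ?thesis
    proof cases
      case 1
      obtain a ks where aks: "w = (a, ks)" by (cases w)
      obtain k1 k2 where k: "w1 = (a, ks @ [k1])" "w2 = (a, ks @ [k2])" using 1 aks by auto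
      have s: "(pi2 k1, pi3 k1) \<in> succs w" "(pi2 k2, pi3 k2) \<in> succs w"
        and r: "r \<in> pi2 k1" "r \<in> pi2 k2" and p: "pi1 k1 = pi1 k2"
        using w1(2) w2(2) k aks by (auto simp: universe_snoc)
      \<comment> \<open>The union of both successor types is entailed; by maximality each of them
        already equals the union.\<close>
      have "entails_ex \<T> (label w) (pi2 k1 \<union> pi2 k2) (pi3 k1 \<union> pi3 k2)"
        using entails_ex_merge[OF _ _ ax X r] succs_entails[OF u(1) s(1)] succs_entails[OF u(1) s(2)]
          Y k by simp
      then have "pi2 k1 = pi2 k2" "pi3 k1 = pi3 k2"
        using succs_maximal[OF u(1) s(1)] succs_maximal[OF u(1) s(2)] by blast+
      then show ?thesis using k p by (simp add: prod_eq_iff)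
    next
      case 2
      show ?thesis
      proof (cases "snd w = []")
        case True
        then obtain a b c where abc: "w = (a, [])" "w1 = (b, [])" "w2 = (c, [])"
          using 2 w1(2) w2(2) by (auto simp: role_ext_CM)
        \<comment> \<open>The axiom in \<open>I0\<close> equates the denotations of \<open>b\<close>
          and \<open>c\<close>, and distinct individuals denote distinct elements.\<close>
        obtain h where h: "homomorphism (inds \<A>) h CM I0" using homomorphism_into_I0 .
        have "h w1 = h w2"
          using sat_tboxD[OF I0_tbox ax] homomorphism_basic[OF h interp_CM w]
            homomorphism_basic[OF h interp_CM w1(1)] homomorphism_basic[OF h interp_CM w2(1)]
            homomorphism_role[OF h interp_CM w1(2)] homomorphism_role[OF h interp_CM w2(2)] by auto
        moreover have "h (b, []) = den I0 b" "h (c, []) = den I0 c" "inj_on (den I0) (inds \<A>)"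
          using h u abc I0 by (auto simp: homomorphism_def is_model_def)
        ultimately show ?thesis using abc u by (auto dest: inj_onD)
      next
        case False
        \<comment> \<open>The only non-child neighbour of a word with letters is its parent.\<close>
        then show ?thesis using 2 w1(2) w2(2) by (auto simp: role_ext_CM)
      qed
    qed
  qed
  then show ?thesis by auto
qed

section \<open>The universal core property and uniqueness\<close>

lemma model_CM: "is_model CM \<T> \<A>"
proof -
  have "sat_axiom CM \<tau>" if "\<tau> \<in> \<T>" for \<tau>
    using that sat_CM_ConjSub sat_CM_AtMostOne sat_CM_ForallSub sat_CM_ExistsSub sat_CM_RoleSub
    by (cases \<tau>) blast+
  then have "sat_tbox CM \<T>" using interp_CM by (simp add: sat_tbox_def)
  moreover have "sat_assertion CM \<alpha>" if "\<alpha> \<in> \<A>" for \<alpha>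
  proof (cases \<alpha>)
    case (CA A a)
    then show ?thesis using that closure_abox.assertion[OF that, of \<T>] closure_inds
      by (fastforce simp: cext_CM concepts_of_def)
  next
    case (RA r a b)
    then show ?thesis using closure_abox.assertion[OF that, of \<T>]
        role_ext_CM_Nil_Nil[of a b "Role r"] by simp
  qed
  ultimately show ?thesis by (auto simp: is_model_def inj_on_def)
qed

lemma universal_core_model_CM: "universal_core_model TYPE('e) \<T> \<A> CM"
  using model_CM core_CM homomorphism_into_model
  by (auto simp: universal_core_model_def universal_model_def)

text \<open>Homomorphisms \<open>h\<close> and \<open>g\<close> exist in both directions;
  universality of \<open>I\<close> is needed only over the type of words, where the canonical model
  lives. Rigidity makes \<open>h \<circ> g\<close> the identity, so \<open>h\<close> is onto, and
  the core property of \<open>I\<close> makes \<open>g \<circ> h\<close> strong and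
  injective.\<close>

lemma universal_core_model_isomorphic:
  fixes I :: "('f, 'c, 'r, 'i) ind_interp"
  assumes "universal_core_model TYPE(('i, 'c, 'r) word) \<T> \<A> I"
  shows "isomorphic (inds \<A>) I CM"
proof -
  have I: "is_model I \<T> \<A>" and coreI: "core (inds \<A>) I"
    using assms by (auto simp: universal_core_model_def universal_model_def)
  obtain h where h: "homomorphism (inds \<A>) h I CM"
    using assms model_CM by (auto simp: universal_core_model_def universal_model_def)
  obtain g where g: "homomorphism (inds \<A>) g CM I"
    using homomorphism_into_model[OF I] by blast
  have hU: "h x \<in> U" if "x \<in> universe I" for x using h that by (auto simp: homomorphism_def)
  have gU: "g x \<in> universe I" if "x \<in> U" for x using g that by (auto simp: homomorphism_def)
  have "homomorphism (inds \<A>) (h \<circ> g) CM CM"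
    using g h hU gU by (simp add: homomorphism_def image_subset_iff)
  then have hg: "h (g x) = x" if "x \<in> U" for x
    using endomorphism_eq[of "h \<circ> g" x] that by simp
  have "homomorphism (inds \<A>) (g \<circ> h) I I"
    using g h hU gU by (simp add: homomorphism_def image_subset_iff)
  then have gh: "strong_homomorphism (inds \<A>) (g \<circ> h) I I" "inj_on (g \<circ> h) (universe I)"
    using coreI by (auto simp: core_def)
  have "bij_betw h (universe I) (universe CM)"
    unfolding bij_betw_def
  proof
    show "inj_on h (universe I)" using gh(2) by (rule inj_on_imageI2)
    have "x \<in> h ` universe I" if "x \<in> U" for x
      using imageI[OF gU[OF that], of h] hg[OF that] by simp
    then show "h ` universe I = universe CM" using hU by auto
  qed
  moreover have "strong_homomorphism (inds \<A>) h I CM"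
    unfolding strong_homomorphism_def
  proof (intro conjI allI ballI impI)
    \<comment> \<open>Facts about \<open>h e\<close> are carried back to \<open>I\<close> by
      \<open>g\<close> and then reflected by the strong map \<open>g \<circ> h\<close>; the same
      works for roles.\<close>
    fix A e assume "e \<in> universe I" "h e \<in> cext CM A"
    then show "e \<in> cext I A"
      using g gh(1) hU by (simp add: homomorphism_def strong_homomorphism_def)
  next
    fix r e f assume "e \<in> universe I" "f \<in> universe I" "(h e, h f) \<in> rext CM r"
    then show "(e, f) \<in> rext I r"
      using g gh(1) hU by (simp add: homomorphism_def strong_homomorphism_def)
  qed (rule h)
  ultimately show ?thesis unfolding isomorphic_def by blast
qed

end

theorem mainTheorem5:
  fixes \<T> :: "('c, 'r) tbox_axiom set" and \<A> :: "('i, 'c, 'r) assertion set"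
  assumes "finite \<T>" and "finite \<A>" and "\<A> \<noteq> {}"
    and "consistent TYPE('d) \<T> \<A>"
  shows "universal_core_model TYPE('e) \<T> \<A> (can \<T> \<A>) \<and>
    (\<forall>I :: ('f, 'c, 'r, 'i) ind_interp.
       universal_core_model TYPE(('i, 'c, 'r) word) \<T> \<A> I \<longrightarrow>
       isomorphic (inds \<A>) I (can \<T> \<A>))"
proof -
  obtain I0 :: "('d, 'c, 'r, 'i) ind_interp" where "is_model I0 \<T> \<A>"
    "finite {A. cext I0 A \<noteq> {}}" "finite {r. rext I0 r \<noteq> {}}"
    using finite_signature_model[OF assms(1,2,4)] .
  then interpret horn_kb \<T> \<A> I0
    using assms by unfold_locales (auto intro: countable_finite)
  show ?thesis using universal_core_model_CM universal_core_model_isomorphic by blast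
qed

end
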